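(* Suppose that $0<\mu\leq M$ on $[0,1]$ for a constant $M$, that $s$ is $C$-Lipschitz on $[0,1]$, and that $q=q_n\to+\infty$ as $n\to+\infty$. Take $k=k_n$ such that $k+1=n^{1/3}$ up to rounding to an integer (i.e. $k$ is an integer with $|k+1-n^{1/3}|<1$). Then there is a positive constant $K$, not depending on $n$, such that the risk of a purely uniformly random forest (PURF) satisfies $$\mathbb{E}\big[(\hat{s}(X)-s(X))^2\big]\leq K n^{-2/3}+o(n^{-2/3})\quad (n\to+\infty).$$
   Context: Model: $(X_1,Y_1),\dots,(X_n,Y_n)$ are i.i.d. copies of $(X,Y)$ (the learning sample $\mathcal{L}_n$), with $Y_i=s(X_i)+\varepsilon_i$, where $s:[0,1]\to\mathbb{R}$ is the (fixed, unknown) regression function, $X\in[0,1]$ has a continuous density $\mu$ on $[0,1]$, and $\varepsilon_1,\dots,\varepsilon_n$ are i.i.d. copies of a real random variable $\varepsilon$, independent of $(X_1,\dots,X_n)$, with $\mathbb{E}[\varepsilon]=0$ and $\mathrm{Var}(\varepsilon)=\sigma^2$. In risks, $X$ denotes a new point with density $\mu$, independent of $\mathcal{L}_n$ and of the random partitions. Trees: for a natural integer $k$ and a vector $\mathbb{U}=(U_1,\dots,U_k)$ of i.i.d. uniform variables on $[0,1]$, independent of $\mathcal{L}_n$ and $X$, with order statistics $U_{(1)}\leq\dots\leq U_{(k)}$ and $U_{(0)}=0$, $U_{(k+1)}=1$, set for $x\in[0,1]$ $$\hat{s}_{\mathbb{U}}(x)=\sum_{j=0}^k\hat\beta_j\mathbf{1}_{U_{(j)}<x\leq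 U_{(j+1)}},$$ where $\hat\beta_j$ is the average of the $Y_i$ over the indices $i$ with $U_{(j)}<X_i\leq U_{(j+1)}$ (and $\hat\beta_j=0$ if there are none). Forest: $\mathbb{U}^1,\dots,\mathbb{U}^q$ are i.i.d. copies of $\mathbb{U}$, independent of $\mathcal{L}_n$ and $X$, and the purely uniformly random forest (PURF) is $\hat{s}(x)=\frac1q\sum_{l=1}^q\hat{s}_{\mathbb{U}^l}(x)$. *)

theory Defs
  imports "HOL-Probability.Probability" "HOL-Library.Landau_Symbols"
begin

text \<open>
  Random vectors and samples are indexed from 1. For cut points \<open>u 1, \<dots>, u k\<close>, \<open>ordered_cut k u j\<close> is
  the \<open>j\<close>-th order statistic, completed by 0 at \<open>j = 0\<close> and by 1 at \<open>j = k + 1\<close>.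
\<close>

definition ordered_cut :: "nat \<Rightarrow> (nat \<Rightarrow> real) \<Rightarrow> nat \<Rightarrow> real" where
  "ordered_cut k u j =
     (if j = 0 then 0 else if j = k + 1 then 1 else sort (map u [1..<k + 1]) ! (j - 1))"

definition tree_cell :: "nat \<Rightarrow> (nat \<Rightarrow> real) \<Rightarrow> nat \<Rightarrow> real set" where
  "tree_cell k u j = {ordered_cut k u j <.. ordered_cut k u (j + 1)}"

definition cell_mean :: "nat \<Rightarrow> (nat \<Rightarrow> real) \<Rightarrow> (nat \<Rightarrow> real) \<Rightarrow> real set \<Rightarrow> real" where
  "cell_mean n xs ys A =
     (let I = {i \<in> {1..n}. xs i \<in> A}
      in if I = {} then 0 else (\<Sum>i\<in>I. ys i) / real (card I))"

definition tree_estimator ::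
  "nat \<Rightarrow> (nat \<Rightarrow> real) \<Rightarrow> (nat \<Rightarrow> real) \<Rightarrow> nat \<Rightarrow> (nat \<Rightarrow> real) \<Rightarrow> real \<Rightarrow> real" where
  "tree_estimator n xs ys k u x =
     (\<Sum>j = 0..k. cell_mean n xs ys (tree_cell k u j) * indicator (tree_cell k u j) x)"

definition forest_estimator ::
  "nat \<Rightarrow> (nat \<Rightarrow> real) \<Rightarrow> (nat \<Rightarrow> real) \<Rightarrow> nat \<Rightarrow> nat \<Rightarrow> (nat \<Rightarrow> nat \<Rightarrow> real) \<Rightarrow> real \<Rightarrow> real" where
  "forest_estimator n xs ys q k us x =
     1 / real q * (\<Sum>l = 1..q. tree_estimator n xs ys k (us l) x)"

definition forest_sq_error ::
  "nat \<Rightarrow> nat \<Rightarrow> nat \<Rightarrow> (real \<Rightarrow> real) \<Rightarrow> (nat \<Rightarrow> 'a \<Rightarrow> real) \<Rightarrow> (nat \<Rightarrow> 'a \<Rightarrow> real) \<Rightarrow>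
   (nat \<Rightarrow> nat \<Rightarrow> 'a \<Rightarrow> real) \<Rightarrow> ('a \<Rightarrow> real) \<Rightarrow> 'a \<Rightarrow> real" where
  "forest_sq_error n q k s X Y U X0 \<omega> =
     (forest_estimator n (\<lambda>i. X i \<omega>) (\<lambda>i. Y i \<omega>) q k (\<lambda>l i. U l i \<omega>) (X0 \<omega>) - s (X0 \<omega>))\<^sup>2"

text \<open>
  Names for the primitive random variables: design points, noise terms, the new point, and the
  cut points (tree, position). The independence requirements of the model amount to
  mutual independence of this whole family.
\<close>

datatype source = Design nat | Noise nat | New_Point | Cut nat nat

definition sources :: "nat \<Rightarrow> nat \<Rightarrow> nat \<Rightarrow> source set" where
  "sources n q k =
     Design ` {1..n} \<union> Noise ` {1..n} \<union> {New_Point} \<union> {Cut l i | l i. l \<in> {1..q} \<and> i \<in> {1..k}}"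

text \<open>
  The model at sample size \<open>n\<close> with \<open>q\<close> trees of \<open>k\<close> cut points. \<open>\<nu>\<close> is the law of the noise variable.
  The design points take values in the unit interval everywhere, not just almost surely, so that
  the values of \<open>s\<close> outside of it play no role.
\<close>

locale purf_model = prob_space P
  for P :: "'a measure" +
  fixes n q k :: nat
    and s \<mu> :: "real \<Rightarrow> real"
    and \<nu> :: "real measure"
    and \<sigma> :: real
    and X Y \<epsilon> :: "nat \<Rightarrow> 'a \<Rightarrow> real"
    and X0 :: "'a \<Rightarrow> real"
    and U :: "nat \<Rightarrow> nat \<Rightarrow> 'a \<Rightarrow> real"
  assumes \<mu>_continuous: "continuous_on {0..1} \<mu>"
    and X_range: "\<And>i \<omega>. i \<in> {1..n} \<Longrightarrow> \<omega> \<in> space P \<Longrightarrow> X i \<omega> \<in> {0..1}"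
    and X0_range: "\<And>\<omega>. \<omega> \<in> space P \<Longrightarrow> X0 \<omega> \<in> {0..1}"
    and X_density: "\<And>i. i \<in> {1..n} \<Longrightarrow>
          distributed P lborel (X i) (\<lambda>x. ennreal (\<mu> x * indicator {0..1} x))"
    and X0_density: "distributed P lborel X0 (\<lambda>x. ennreal (\<mu> x * indicator {0..1} x))"
    and \<nu>_prob: "prob_space \<nu>" "sets \<nu> = sets borel"
    and \<nu>_square_integrable: "integrable \<nu> (\<lambda>e. e\<^sup>2)"
    and \<nu>_mean: "prob_space.expectation \<nu> (\<lambda>e. e) = 0"
    and \<nu>_variance: "prob_space.variance \<nu> (\<lambda>e. e) = \<sigma>\<^sup>2"
    and \<epsilon>_law: "\<And>i. i \<in> {1..n} \<Longrightarrow> distr P borel (\<epsilon> i) = \<nu>"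
    and U_law: "\<And>l i. l \<in> {1..q} \<Longrightarrow> i \<in> {1..k} \<Longrightarrow>
          distr P borel (U l i) = uniform_measure lborel {0..1}"
    and independence: "indep_vars (\<lambda>_. borel)
          (\<lambda>v. case v of Design i \<Rightarrow> X i | Noise i \<Rightarrow> \<epsilon> i | New_Point \<Rightarrow> X0 | Cut l i \<Rightarrow> U l i)
          (sources n q k)"
    and Y_eq: "\<And>i \<omega>. i \<in> {1..n} \<Longrightarrow> \<omega> \<in> space P \<Longrightarrow> Y i \<omega> = s (X i \<omega>) + \<epsilon> i \<omega>"

end

theory Submission
  imports Defs
begin

text \<open>
  The square is convex, so the risk of a forest with at least one tree is at most the risk of a single
  tree, and there are only finitely many sample sizes at which the forest has no tree. It remains to
  bound the risk of one tree by a multiple of \<open>1 / (k + 1)\<^sup>2 + (k + 1) / n\<close>, which the choice of \<open>k\<close>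
  balances at \<open>n powr (-2/3)\<close> (\<open>risk_bound_rate\<close>).

  The cell of a point \<open>x\<close> is determined by the number of cut points below \<open>x\<close>. Call the sample points
  in the cell of the new point its neighbours, and let \<open>N\<close> be their number. The squared error of the
  tree is then at most the sum of three terms (\<open>tree_sq_error_le\<close>).

  The bias is at most the Lipschitz constant times the distance to the farthest neighbour. If that
  distance exceeds \<open>t\<close>, then all cuts miss an interval of length \<open>t\<close> on one side of the new point,
  which has probability at most \<open>2 * (1 - t) ^ k\<close> (\<open>spread_tail\<close>); integrating the tail gives a second
  moment of order \<open>1 / (k + 1)\<^sup>2\<close>.

  Conditionally on everything else, the averaged noise has variance \<open>\<sigma>\<^sup>2 / N\<close>, and an empty cell costs at
  most the squared supremum of the regression function. Both are controlled by the expectation of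
  \<open>1 / (1 + N)\<close>. Given the cuts, the new point and the sample are exchangeable, so this expectation
  does not change when another of the \<open>n + 1\<close> points takes the role of the new point; summing over all
  of them yields the number of occupied cells, at most \<open>k + 1\<close>. So the expectation is at most
  \<open>(k + 1) / (n + 1)\<close> (\<open>expected_inverse_cell_size\<close>).
\<close>


section \<open>Cells described by counting cut points\<close>

definition cut_count :: "nat \<Rightarrow> (nat \<Rightarrow> real) \<Rightarrow> real \<Rightarrow> nat" where
  "cut_count k u x = card {i \<in> {1..k}. u i < x}"

lemma cut_count_le: "cut_count k u x \<le> k"
proof -
  have "cut_count k u x \<le> card {1..k}"
    unfolding cut_count_def by (intro card_mono) auto
  then show ?thesis by simp
qed

lemma cut_count_cong: "(\<And>i. i \<in> {1..k} \<Longrightarrow> u i = v i) \<Longrightarrow> cut_count k u x = cut_count k v x"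
  unfolding cut_count_def by (intro arg_cong[where f = card]) auto

lemma measurable_cut_count:
  assumes "\<And>i. i \<in> {1..k} \<Longrightarrow> (\<lambda>\<omega>. u \<omega> i) \<in> borel_measurable M" and "x \<in> borel_measurable M"
  shows "(\<lambda>\<omega>. cut_count k (u \<omega>) (x \<omega>)) \<in> measurable M (count_space UNIV)"
proof -
  have "cut_count k (u \<omega>) (x \<omega>) = (\<Sum>i = 1..k. if u \<omega> i < x \<omega> then 1 else 0)" for \<omega>
    unfolding cut_count_def by (simp add: sum.If_cases Int_def)
  moreover have "(\<lambda>\<omega>. \<Sum>i = 1..k. if u \<omega> i < x \<omega> then 1 else 0 :: nat) \<in> borel_measurable M"
    using assms by (intro borel_measurable_sum measurable_If) auto
  ultimately show ?thesis
    by (simp add: measurable_cong_sets[OF refl sets_borel_eq_count_space])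
qed

lemma pred_equal_cut_count:
  assumes u: "\<And>i. i \<in> {1..k} \<Longrightarrow> (\<lambda>\<omega>. u \<omega> i) \<in> borel_measurable M"
    and x: "x \<in> borel_measurable M" and y: "y \<in> borel_measurable M"
  shows "Measurable.pred M (\<lambda>\<omega>. cut_count k (u \<omega>) (x \<omega>) = cut_count k (u \<omega>) (y \<omega>))"
proof -
  have real_count: "(\<lambda>\<omega>. real (cut_count k (u \<omega>) (z \<omega>))) \<in> borel_measurable M"
    if "z \<in> borel_measurable M" for z
    using measurable_cut_count[OF u that] by (rule measurable_compose) auto
  show ?thesis
    using borel_measurable_eq[OF real_count[OF x] real_count[OF y]] by (simp add: pred_def)
qed

lemma sorted_nth_less_iff:
  fixes xs :: "'b::linorder list"
  assumes "sorted xs" and "j < length xs"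
  shows "xs ! j < x \<longleftrightarrow> j < length (filter (\<lambda>y. y < x) xs)"
  using assms
proof (induction xs arbitrary: j)
  case (Cons a xs)
  show ?case
  proof (cases "a < x")
    case True
    then show ?thesis using Cons by (cases j) auto
  next
    case False
    then have none: "filter (\<lambda>y. y < x) (a # xs) = []"
      using Cons.prems by (auto simp: filter_empty_conv)
    have "a \<le> (a # xs) ! j"
      using Cons.prems by (cases j) auto
    then show ?thesis using False none by simp
  qed
qed simp

lemma ordered_cut_less_iff:
  assumes "j \<in> {1..k}"
  shows "ordered_cut k u j < x \<longleftrightarrow> j \<le> cut_count k u x"
proof -
  have "length (filter (\<lambda>y. y < x) (sort (map u [1..<k + 1])))
      = length (filter (\<lambda>i. u i < x) [1..<k + 1])"
    by (simp add: filter_sort filter_map o_def)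
  also have "\<dots> = cut_count k u x"
    unfolding cut_count_def
    by (subst distinct_card[symmetric]) (auto intro!: arg_cong[where f = card])
  finally have count: "length (filter (\<lambda>y. y < x) (sort (map u [1..<k + 1]))) = cut_count k u x" .
  have "ordered_cut k u j < x \<longleftrightarrow> j - 1 < cut_count k u x"
    using assms sorted_nth_less_iff[of "sort (map u [1..<k + 1])" "j - 1" x, unfolded count]
    by (auto simp: ordered_cut_def simp del: upt_Suc)
  then show ?thesis using assms by auto
qed

text \<open>
  The \<open>j\<close>-th order statistic lies below \<open>x\<close> exactly when at least \<open>j\<close> cut points do, and the two
  boundary values 0 and 1 behave in the same way for \<open>x\<close> in the half-open unit interval. Hence the
  index of the cell of \<open>x\<close> is the number of cut points below \<open>x\<close>, and sorting disappears from the
  analysis: two points share a cell when they have equal counts.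
\<close>

lemma in_tree_cell_iff:
  assumes "x \<in> {0<..1}" and "j \<le> k"
  shows "x \<in> tree_cell k u j \<longleftrightarrow> cut_count k u x = j"
proof -
  have *: "ordered_cut k u j < x \<longleftrightarrow> j \<le> cut_count k u x" if "j \<le> k + 1" for j
  proof -
    have "j = 0 \<or> j \<in> {1..k} \<or> j = k + 1" using that by auto
    then consider "j = 0" | "j \<in> {1..k}" | "j = k + 1" by blast
    then show ?thesis
    proof cases
      case 3
      then show ?thesis
        using assms(1) cut_count_le[of k u x] by (simp add: ordered_cut_def)
    qed (use assms(1) ordered_cut_less_iff[of j k u x] in \<open>auto simp: ordered_cut_def\<close>)
  qed
  show ?thesis
    using *[of j] *[of "j + 1"] assms(2)
    by (auto simp: tree_cell_def not_less[symmetric])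
qed

text \<open>
  The sublevel sets of an order statistic are described by counts of cut points, and a count is a
  finite sum of measurable indicators.
\<close>

lemma borel_measurable_ordered_cut:
  assumes u: "\<And>i. i \<in> {1..k} \<Longrightarrow> (\<lambda>\<omega>. u \<omega> i) \<in> borel_measurable M" and "j \<le> k + 1"
  shows "(\<lambda>\<omega>. ordered_cut k (u \<omega>) j) \<in> borel_measurable M"
proof (cases "j \<in> {1..k}")
  case True
  have "{\<omega> \<in> space M. ordered_cut k (u \<omega>) j < a} \<in> sets M" for a
  proof -
    have [measurable]: "(\<lambda>\<omega>. cut_count k (u \<omega>) a) \<in> measurable M (count_space UNIV)"
      using u by (rule measurable_cut_count) auto
    show ?thesis
      unfolding ordered_cut_less_iff[OF True] by measurable
  qed
  then show ?thesis by (simp add: borel_measurable_iff_less)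
next
  case False
  then have "j = 0 \<or> j = k + 1" using assms(2) by auto
  then show ?thesis by (auto simp: ordered_cut_def)
qed

text \<open>
  Because \<open>0 / 0 = 0\<close>, this single quotient also gives the value 0 that the mean has on an empty cell.
  In this form measurability in the sample and in the cell is immediate.
\<close>

lemma cell_mean_eq_ratio:
  "cell_mean n xs ys A =
     (\<Sum>i = 1..n. indicator A (xs i) * ys i) / (\<Sum>i = 1..n. indicator A (xs i))"
proof -
  have "(\<Sum>i = 1..n. indicator A (xs i) * ys i) = (\<Sum>i | i \<in> {1..n} \<and> xs i \<in> A. ys i)"
    by (simp add: sum.If_cases Int_def indicator_def if_distrib if_distribR cong: if_cong)
  moreover have "(\<Sum>i = 1..n. indicator A (xs i)) = real (card {i \<in> {1..n}. xs i \<in> A})"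
    by (simp add: sum.If_cases Int_def indicator_def cong: if_cong)
  ultimately show ?thesis by (simp add: cell_mean_def Let_def)
qed

lemma borel_measurable_tree_estimator:
  assumes [measurable]: "\<And>i. i \<in> {1..n} \<Longrightarrow> (\<lambda>\<omega>. xs \<omega> i) \<in> borel_measurable M"
      "\<And>i. i \<in> {1..n} \<Longrightarrow> (\<lambda>\<omega>. ys \<omega> i) \<in> borel_measurable M"
      "\<And>i. i \<in> {1..k} \<Longrightarrow> (\<lambda>\<omega>. u \<omega> i) \<in> borel_measurable M" "x \<in> borel_measurable M"
  shows "(\<lambda>\<omega>. tree_estimator n (xs \<omega>) (ys \<omega>) k (u \<omega>) (x \<omega>)) \<in> borel_measurable M"
proof -
  have ind: "(\<lambda>\<omega>. indicator (tree_cell k (u \<omega>) j) (z \<omega>) :: real) \<in> borel_measurable M"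
    if "j \<le> k" and [measurable]: "z \<in> borel_measurable M" for j z
  proof -
    have [measurable]: "(\<lambda>\<omega>. ordered_cut k (u \<omega>) j) \<in> borel_measurable M"
        "(\<lambda>\<omega>. ordered_cut k (u \<omega>) (j + 1)) \<in> borel_measurable M"
      using that by (auto intro!: borel_measurable_ordered_cut)
    show ?thesis
      unfolding tree_cell_def indicator_def greaterThanAtMost_iff by measurable
  qed
  show ?thesis
    unfolding tree_estimator_def cell_mean_eq_ratio
    by (intro borel_measurable_sum borel_measurable_times borel_measurable_divide ind) auto
qed

lemma tree_estimator_eq_cut_count:
  fixes k :: nat and u :: "nat \<Rightarrow> real"
  assumes "x \<in> {0<..1}" and "\<And>i. i \<in> {1..n} \<Longrightarrow> xs i \<in> {0<..1}"
  defines "I \<equiv> {i \<in> {1..n}. cut_count k u (xs i) = cut_count k u x}"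
  shows "tree_estimator n xs ys k u x = (\<Sum>i\<in>I. ys i) / real (card I)"
proof -
  let ?c = "cut_count k u x"
  have "tree_estimator n xs ys k u x
      = (\<Sum>j = 0..k. if j = ?c then cell_mean n xs ys (tree_cell k u j) else 0)"
    unfolding tree_estimator_def
    using assms(1) by (intro sum.cong) (auto simp: indicator_def in_tree_cell_iff)
  also have "\<dots> = cell_mean n xs ys (tree_cell k u ?c)"
    using cut_count_le[of k u x] by simp
  also have "\<dots> = (\<Sum>i\<in>I. ys i) / real (card I)"
  proof -
    have "{i \<in> {1..n}. xs i \<in> tree_cell k u ?c} = I"
      using assms(2) cut_count_le[of k u x] by (auto simp: I_def in_tree_cell_iff)
    then show ?thesis by (simp add: cell_mean_def Let_def)
  qed
  finally show ?thesis .
qed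

lemma equal_cut_count_imp_gap:
  assumes "cut_count k u x = cut_count k u y" and "x \<le> y" and "i \<in> {1..k}"
  shows "u i \<notin> {x..<y}"
proof -
  have "{i \<in> {1..k}. u i < x} = {i \<in> {1..k}. u i < y}"
    using assms(1,2) unfolding cut_count_def by (intro card_subset_eq) auto
  then have "u i < x \<longleftrightarrow> u i < y" using assms(3) by blast
  then show ?thesis by auto
qed

section \<open>Deterministic decomposition of the error\<close>

text \<open>
  In a nonempty cell the error is a bias plus an average of the noise, and the square of a sum is at
  most twice the sum of the squares; this wastes a factor 2 but no cross term has to be treated. In
  an empty cell the estimate is 0, and the error is the target value \<open>c\<close> itself.
\<close>

lemma local_mean_sq_error_le:
  fixes f e :: "'i \<Rightarrow> real"
  assumes "finite I" and "\<And>i. i \<in> I \<Longrightarrow> \<bar>f i - c\<bar> \<le> d" and "0 \<le> d" and "\<bar>c\<bar> \<le> S"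
  shows "((\<Sum>i\<in>I. f i + e i) / real (card I) - c)\<^sup>2
    \<le> 2 * d\<^sup>2 + 2 * ((\<Sum>i\<in>I. e i) / real (card I))\<^sup>2 + S\<^sup>2 * of_bool (I = {})"
proof (cases "I = {}")
  case True
  have "c\<^sup>2 \<le> S\<^sup>2" using assms(4) by (simp add: abs_le_square_iff[symmetric])
  moreover have "0 \<le> d\<^sup>2" by simp
  ultimately have "c\<^sup>2 \<le> 2 * d\<^sup>2 + S\<^sup>2" by linarith
  then show ?thesis using True by simp
next
  case False
  then have pos: "real (card I) > 0" using assms(1) by (simp add: card_gt_0_iff)
  define b where "b = (\<Sum>i\<in>I. f i - c) / real (card I)"
  define v where "v = (\<Sum>i\<in>I. e i) / real (card I)"
  have "\<bar>\<Sum>i\<in>I. f i - c\<bar> \<le> (\<Sum>i\<in>I. d)"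
    by (rule order_trans[OF sum_abs sum_mono[OF assms(2)]])
  then have "\<bar>b\<bar> \<le> \<bar>d\<bar>"
    using pos assms(3) by (simp add: b_def abs_divide field_simps)
  then have "b\<^sup>2 \<le> d\<^sup>2" by (simp add: abs_le_square_iff)
  moreover have "(\<Sum>i\<in>I. f i + e i) / real (card I) - c = b + v"
    using pos by (simp add: b_def v_def sum.distrib sum_subtractf field_simps)
  moreover have "(b + v)\<^sup>2 \<le> 2 * b\<^sup>2 + 2 * v\<^sup>2"
    using zero_le_power2[of "b - v"] by (simp add: power2_eq_square algebra_simps)
  ultimately show ?thesis using False by (simp add: v_def)
qed

section \<open>Expectations under independence\<close>

text \<open>
  Freezing: of two independent variables, the first may be held fixed while the expectation over the
  second is computed. Every use of independence between different parts of the model below has this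
  form.
\<close>

lemma (in prob_space) nn_integral_indep_var:
  assumes ind: "indep_var S A T B" and f: "f \<in> borel_measurable (S \<Otimes>\<^sub>M T)"
  shows "(\<integral>\<^sup>+\<omega>. f (A \<omega>, B \<omega>) \<partial>M) = (\<integral>\<^sup>+\<omega>. (\<integral>\<^sup>+\<omega>'. f (A \<omega>, B \<omega>') \<partial>M) \<partial>M)"
proof -
  have [measurable]: "A \<in> measurable M S" "B \<in> measurable M T"
    and eq: "distr M S A \<Otimes>\<^sub>M distr M T B = distr M (S \<Otimes>\<^sub>M T) (\<lambda>\<omega>. (A \<omega>, B \<omega>))"
    using ind by (auto simp: indep_var_distribution_eq)
  note f[measurable]
  interpret B: prob_space "distr M T B" by (rule prob_space_distr) measurable
  have "(\<integral>\<^sup>+\<omega>. f (A \<omega>, B \<omega>) \<partial>M) = (\<integral>\<^sup>+z. f z \<partial>distr M (S \<Otimes>\<^sub>M T) (\<lambda>\<omega>. (A \<omega>, B \<omega>)))"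
    by (subst nn_integral_distr) auto
  also have "\<dots> = (\<integral>\<^sup>+a. (\<integral>\<^sup>+b. f (a, b) \<partial>distr M T B) \<partial>distr M S A)"
    unfolding eq[symmetric] by (subst B.nn_integral_fst) (auto cong: measurable_cong_sets)
  also have "\<dots> = (\<integral>\<^sup>+\<omega>. (\<integral>\<^sup>+b. f (A \<omega>, b) \<partial>distr M T B) \<partial>M)"
    by (subst nn_integral_distr) (auto intro!: B.borel_measurable_nn_integral)
  also have "\<dots> = (\<integral>\<^sup>+\<omega>. (\<integral>\<^sup>+\<omega>'. f (A \<omega>, B \<omega>') \<partial>M) \<partial>M)"
    by (intro nn_integral_cong) (subst nn_integral_distr, auto dest: measurable_space)
  finally show ?thesis .
qed

text \<open>
  The members of a class of size \<open>c\<close> contribute \<open>1 / c\<close> each, so every class contributes 1.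
\<close>

lemma sum_inverse_class_size:
  assumes "finite J"
  shows "(\<Sum>m\<in>J. 1 / real (card {j \<in> J. g j = g m})) = real (card (g ` J))"
proof -
  have "(\<Sum>m\<in>J. 1 / real (card {j \<in> J. g j = g m}))
      = (\<Sum>y\<in>g ` J. \<Sum>m\<in>{m \<in> J. g m = y}. 1 / real (card {j \<in> J. g j = g m}))"
    using assms by (rule sum.image_gen)
  also have "\<dots> = (\<Sum>y\<in>g ` J. 1)"
  proof (rule sum.cong[OF refl])
    fix y assume "y \<in> g ` J"
    then have "{m \<in> J. g m = y} \<noteq> {}" by auto
    then show "(\<Sum>m\<in>{m \<in> J. g m = y}. 1 / real (card {j \<in> J. g j = g m})) = 1"
      using assms by (simp add: card_eq_0_iff)
  qed
  finally show ?thesis by simp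
qed

text \<open>
  Exchangeability: the joint law of the \<open>Z j\<close> is a power of \<open>D\<close>, hence invariant under transposing
  \<open>j0\<close> with any other index, so that the expectation is the same for all choices of the marked index.
  The sum over all choices is the number of occupied classes, of which there are at most \<open>k + 1\<close>.
\<close>

lemma (in prob_space) expected_inverse_class_size:
  fixes Z :: "'i \<Rightarrow> 'a \<Rightarrow> 'b::topological_space" and g :: "'b \<Rightarrow> nat"
  assumes J: "finite J" "j0 \<in> J"
    and ind: "indep_vars (\<lambda>_. borel) Z J"
    and law: "\<And>j. j \<in> J \<Longrightarrow> distr M borel (Z j) = D"
    and g[measurable]: "g \<in> measurable borel (count_space UNIV)" and g_le: "\<And>x. g x \<le> k"
  shows "(\<integral>\<^sup>+\<omega>. ennreal (1 / real (card {j \<in> J. g (Z j \<omega>) = g (Z j0 \<omega>)})) \<partial>M)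
    \<le> ennreal (real (k + 1) / real (card J))"
proof -
  define h where "h m z = ennreal (1 / real (card {j \<in> J. g (z j) = g (z m)}))" for m z
  define Q where "Q = PiM J (\<lambda>_. D)"
  have Z[measurable]: "Z j \<in> borel_measurable M" if "j \<in> J" for j
    using ind that by (auto simp: indep_vars_def)
  have D: "prob_space D" "sets D = sets borel"
    using law[OF J(2)] prob_space_distr[OF Z[OF J(2)]] by (auto simp: sets_distr[symmetric])
  have sets_Q: "sets Q = sets (PiM J (\<lambda>_. borel))"
    unfolding Q_def using D by (intro sets_PiM_cong) auto
  have Q_prob: "prob_space Q"
    unfolding Q_def using D by (intro prob_space_PiM)
  have joint: "distr M (PiM J (\<lambda>_. borel)) (\<lambda>\<omega>. \<lambda>j\<in>J. Z j \<omega>) = Q"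
  proof -
    have "distr M (PiM J (\<lambda>_. borel)) (\<lambda>\<omega>. \<lambda>j\<in>J. Z j \<omega>) = PiM J (\<lambda>j. distr M borel (Z j))"
      using indep_vars_iff_distr_eq_PiM'[where I = J and M' = "\<lambda>_. borel" and X = Z] ind J by auto
    also have "\<dots> = Q" unfolding Q_def using law by (intro PiM_cong) auto
    finally show ?thesis .
  qed
  have h[measurable]: "h m \<in> borel_measurable Q" if "m \<in> J" for m
  proof -
    have [measurable]: "(\<lambda>z. z j) \<in> measurable Q borel" if "j \<in> J" for j
      using that by (simp add: cong: measurable_cong_sets[OF sets_Q refl])
    have "real (card {j \<in> J. g (z j) = g (z m)}) = (\<Sum>j\<in>J. if g (z j) = g (z m) then 1 else 0)" for z
      using J by (simp add: sum.If_cases Int_def)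
    then show ?thesis
      unfolding h_def using that by simp
  qed
  have to_Q: "(\<integral>\<^sup>+\<omega>. h m (\<lambda>j. Z j \<omega>) \<partial>M) = (\<integral>\<^sup>+z. h m z \<partial>Q)" if "m \<in> J" for m
  proof -
    have "(\<integral>\<^sup>+z. h m z \<partial>Q) = (\<integral>\<^sup>+\<omega>. h m (\<lambda>j\<in>J. Z j \<omega>) \<partial>M)"
      unfolding joint[symmetric] using h[OF that]
      by (subst nn_integral_distr) (auto simp: measurable_cong_sets[OF sets_Q refl])
    also have "\<dots> = (\<integral>\<^sup>+\<omega>. h m (\<lambda>j. Z j \<omega>) \<partial>M)"
      using that by (auto simp: h_def intro!: nn_integral_cong arg_cong[where f = card])
    finally show ?thesis ..
  qed
  have swap: "(\<integral>\<^sup>+z. h m z \<partial>Q) = (\<integral>\<^sup>+z. h j0 z \<partial>Q)" if m: "m \<in> J" for m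
  proof -
    let ?\<tau> = "Transposition.transpose m j0"
    have \<tau>: "?\<tau> j \<in> J" if "j \<in> J" for j
      using that m J(2) by (auto simp: Transposition.transpose_def)
    have inv: "distr Q Q (\<lambda>z. \<lambda>j\<in>J. z (?\<tau> j)) = Q"
      unfolding Q_def using D \<tau> by (intro distr_PiM_reindex) (auto intro!: inj_onI)
    have "(\<integral>\<^sup>+z. h m z \<partial>Q) = (\<integral>\<^sup>+z. h m z \<partial>distr Q Q (\<lambda>z. \<lambda>j\<in>J. z (?\<tau> j)))"
      by (simp add: inv)
    also have "\<dots> = (\<integral>\<^sup>+z. h m (\<lambda>j\<in>J. z (?\<tau> j)) \<partial>Q)"
      using \<tau> h[OF m] by (subst nn_integral_distr) (auto simp: Q_def intro!: measurable_restrict)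
    also have "\<dots> = (\<integral>\<^sup>+z. h j0 z \<partial>Q)"
    proof (rule nn_integral_cong)
      fix z
      have "bij_betw ?\<tau> {j \<in> J. g (z j) = g (z j0)} {j \<in> J. g (z (?\<tau> j)) = g (z j0)}"
        using \<tau> by (intro bij_betwI[where g = ?\<tau>]) auto
      then have "card {j \<in> J. g (z (?\<tau> j)) = g (z j0)} = card {j \<in> J. g (z j) = g (z j0)}"
        by (rule bij_betw_same_card[symmetric])
      moreover have "{j \<in> J. g ((\<lambda>j\<in>J. z (?\<tau> j)) j) = g ((\<lambda>j\<in>J. z (?\<tau> j)) m)}
          = {j \<in> J. g (z (?\<tau> j)) = g (z j0)}"
        using m by auto
      ultimately show "h m (\<lambda>j\<in>J. z (?\<tau> j)) = h j0 z"
        by (simp add: h_def)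
    qed
    finally show ?thesis .
  qed
  have "of_nat (card J) * (\<integral>\<^sup>+z. h j0 z \<partial>Q) = (\<Sum>m\<in>J. \<integral>\<^sup>+z. h m z \<partial>Q)"
    using swap by simp
  also have "\<dots> = (\<integral>\<^sup>+z. (\<Sum>m\<in>J. h m z) \<partial>Q)"
    by (simp add: nn_integral_sum)
  also have "\<dots> \<le> (\<integral>\<^sup>+z. ennreal (real (k + 1)) \<partial>Q)"
  proof (rule nn_integral_mono)
    fix z
    have "(\<lambda>j. g (z j)) ` J \<subseteq> {..k}" using g_le by auto
    then have "card ((\<lambda>j. g (z j)) ` J) \<le> card {..k}" by (intro card_mono) auto
    then have "(\<Sum>m\<in>J. 1 / real (card {j \<in> J. g (z j) = g (z m)})) \<le> real (k + 1)"
      using sum_inverse_class_size[OF J(1), of "\<lambda>j. g (z j)"] by simp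
    moreover have "(\<Sum>m\<in>J. h m z) = ennreal (\<Sum>m\<in>J. 1 / real (card {j \<in> J. g (z j) = g (z m)}))"
      by (simp add: h_def sum_ennreal)
    ultimately show "(\<Sum>m\<in>J. h m z) \<le> ennreal (real (k + 1))"
      by (simp only: ennreal_leI)
  qed
  also have "\<dots> = ennreal (real (k + 1))"
    using prob_space.emeasure_space_1[OF Q_prob] by simp
  finally have *: "of_nat (card J) * (\<integral>\<^sup>+z. h j0 z \<partial>Q) \<le> ennreal (real (k + 1))" .
  have pos: "real (card J) > 0" using J by (auto simp: card_gt_0_iff)
  have "(\<integral>\<^sup>+z. h j0 z \<partial>Q)
      = ennreal (1 / real (card J)) * (of_nat (card J) * (\<integral>\<^sup>+z. h j0 z \<partial>Q))"
    using pos by (simp add: mult.assoc[symmetric] ennreal_of_nat_eq_real_of_nat ennreal_mult[symmetric])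
  also have "\<dots> \<le> ennreal (1 / real (card J)) * ennreal (real (k + 1))"
    by (rule mult_left_mono[OF *]) simp
  also have "\<dots> = ennreal (real (k + 1) / real (card J))"
    by (subst ennreal_mult[symmetric]) auto
  finally show ?thesis
    using to_Q[OF J(2)] by (simp add: h_def)
qed

lemma (in prob_space) prob_all_miss_interval:
  fixes V :: "'i \<Rightarrow> 'a \<Rightarrow> real"
  assumes "finite I" and ind: "indep_vars (\<lambda>_. borel) V I"
    and law: "\<And>i. i \<in> I \<Longrightarrow> distr M borel (V i) = uniform_measure lborel {0..1}"
    and x: "0 \<le> x" "0 \<le> t" "x + t \<le> 1"
  shows "emeasure M {\<omega> \<in> space M. \<forall>i\<in>I. V i \<omega> \<notin> {x..<x + t}} = ennreal ((1 - t) ^ card I)"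
proof (cases "I = {}")
  case True
  then show ?thesis by (simp add: emeasure_space_1)
next
  case False
  have V[measurable]: "V i \<in> borel_measurable M" if "i \<in> I" for i
    using ind that by (auto simp: indep_vars_def)
  have one: "prob (V i -` (- {x..<x + t}) \<inter> space M) = 1 - t" if "i \<in> I" for i
  proof -
    have "prob (V i -` (- {x..<x + t}) \<inter> space M)
        = measure (uniform_measure lborel {0..1}) (- {x..<x + t})"
      unfolding law[OF that, symmetric] using that by (subst measure_distr) auto
    also have "\<dots> = measure lborel ({0..1} \<inter> - {x..<x + t})"
      by (subst measure_uniform_measure) auto
    also have "{0..1} \<inter> - {x..<x + t} = {0..1} - {x..<x + t}" by auto
    also have "measure lborel \<dots> = measure lborel {0..1::real} - measure lborel {x..<x + t}"
      using x by (intro measure_Diff) (auto simp: ennreal_mult_less_top)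
    finally show ?thesis using x by simp
  qed
  have "{\<omega> \<in> space M. \<forall>i\<in>I. V i \<omega> \<notin> {x..<x + t}} = (\<Inter>i\<in>I. V i -` (- {x..<x + t}) \<inter> space M)"
    using False by auto
  moreover have "prob (\<Inter>i\<in>I. V i -` (- {x..<x + t}) \<inter> space M)
      = (\<Prod>i\<in>I. prob (V i -` (- {x..<x + t}) \<inter> space M))"
    using False assms(1) by (intro indep_varsD_finite[OF ind]) auto
  ultimately show ?thesis
    using one by (simp add: emeasure_eq_measure)
qed

text \<open>
  The second moment is the integral of \<open>2 * t\<close> against the tail probability, and the integral of
  \<open>4 * t * (1 - t) ^ k\<close> over the unit interval is the stated bound.
\<close>

lemma (in prob_space) second_moment_of_tail:
  fixes Z :: "'a \<Rightarrow> real"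
  assumes Z[measurable]: "Z \<in> borel_measurable M"
    and range: "\<And>\<omega>. \<omega> \<in> space M \<Longrightarrow> Z \<omega> \<in> {0..1}"
    and tail: "\<And>t. t \<in> {0..1} \<Longrightarrow>
      emeasure M {\<omega> \<in> space M. t < Z \<omega>} \<le> ennreal (2 * (1 - t) ^ k)"
  shows "(\<integral>\<^sup>+\<omega>. ennreal ((Z \<omega>)\<^sup>2) \<partial>M) \<le> ennreal (4 / (real (k + 1) * real (k + 2)))"
proof -
  interpret L: pair_sigma_finite M lborel ..
  have layers: "ennreal ((Z \<omega>)\<^sup>2) = (\<integral>\<^sup>+t. ennreal (2 * t) * indicator {0..1} t * indicator {..<Z \<omega>} t \<partial>lborel)"
    if "\<omega> \<in> space M" for \<omega>
  proof -
    have "(\<integral>\<^sup>+t. ennreal (2 * t) * indicator {0..Z \<omega>} t \<partial>lborel) = (Z \<omega>)\<^sup>2 - 0\<^sup>2"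
      using range[OF that]
      by (intro nn_integral_FTC_Icc) (auto intro!: derivative_eq_intros simp: has_real_derivative_iff_has_vector_derivative[symmetric])
    moreover have "AE t in lborel. ennreal (2 * t) * indicator {0..Z \<omega>} t
        = ennreal (2 * t) * indicator {0..1} t * indicator {..<Z \<omega>} t"
      using AE_lborel_singleton[of "Z \<omega>"]
      by eventually_elim (use range[OF that] in \<open>auto simp: indicator_def\<close>)
    ultimately show ?thesis
      by (simp add: nn_integral_cong_AE)
  qed
  have "(\<integral>\<^sup>+\<omega>. ennreal ((Z \<omega>)\<^sup>2) \<partial>M)
      = (\<integral>\<^sup>+\<omega>. (\<integral>\<^sup>+t. ennreal (2 * t) * indicator {0..1} t * indicator {..<Z \<omega>} t \<partial>lborel) \<partial>M)"
    using layers by (intro nn_integral_cong) auto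
  also have "\<dots> = (\<integral>\<^sup>+t. (\<integral>\<^sup>+\<omega>. ennreal (2 * t) * indicator {0..1} t * indicator {..<Z \<omega>} t \<partial>M) \<partial>lborel)"
    unfolding indicator_def by (subst L.Fubini') (auto simp: mult.commute)
  also have "\<dots> \<le> (\<integral>\<^sup>+t. ennreal (4 * (t * (1 - t) ^ k)) * indicator {0..1} t \<partial>lborel)"
  proof (rule nn_integral_mono)
    fix t :: real
    have "(\<integral>\<^sup>+\<omega>. ennreal (2 * t) * indicator {0..1} t * indicator {..<Z \<omega>} t \<partial>M)
        = (\<integral>\<^sup>+\<omega>. ennreal (2 * t) * indicator {0..1} t * indicator {\<omega> \<in> space M. t < Z \<omega>} \<omega> \<partial>M)"
      by (intro nn_integral_cong) (auto simp: indicator_def)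
    also have "\<dots> = ennreal (2 * t) * indicator {0..1} t * emeasure M {\<omega> \<in> space M. t < Z \<omega>}"
      by (subst nn_integral_cmult_indicator) auto
    also have "\<dots> \<le> ennreal (4 * (t * (1 - t) ^ k)) * indicator {0..1} t"
    proof (cases "t \<in> {0..1}")
      case True
      have "ennreal (2 * t) * emeasure M {\<omega> \<in> space M. t < Z \<omega>}
          \<le> ennreal (2 * t) * ennreal (2 * (1 - t) ^ k)"
        using tail[OF True] by (rule mult_left_mono) simp
      also have "\<dots> = ennreal (4 * (t * (1 - t) ^ k))"
        using True by (simp add: ennreal_mult[symmetric] mult_ac)
      finally show ?thesis using True by simp
    qed simp
    finally show "(\<integral>\<^sup>+\<omega>. ennreal (2 * t) * indicator {0..1} t * indicator {..<Z \<omega>} t \<partial>M)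
        \<le> ennreal (4 * (t * (1 - t) ^ k)) * indicator {0..1} t" .
  qed
  also have "\<dots> = ennreal (4 / (real (k + 1) * real (k + 2)))"
  proof -
    \<comment> \<open>Antiderivative of \<open>4 * t * (1 - t) ^ k\<close>, obtained from \<open>t = 1 - (1 - t)\<close>.\<close>
    define F :: "real \<Rightarrow> real" where
      "F t = 4 * ((1 - t) ^ (k + 2) / real (k + 2) - (1 - t) ^ (k + 1) / real (k + 1))" for t
    have "(\<integral>\<^sup>+t. ennreal (4 * (t * (1 - t) ^ k)) * indicator {0..1} t \<partial>lborel) = F 1 - F 0"
    proof (rule nn_integral_FTC_Icc)
      fix t :: real
      have *: "((\<lambda>t. (1 - t) ^ Suc m / real (Suc m)) has_real_derivative - ((1 - t) ^ m)) (at t)" for m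
      proof -
        have "((\<lambda>t. (1 - t) ^ Suc m) has_real_derivative (1 + real m) * (- 1 * (1 - t) ^ m)) (at t)"
          by (rule DERIV_power_Suc) (auto intro!: derivative_eq_intros)
        from DERIV_cdivide[OF this, of "real (Suc m)"] show ?thesis by simp
      qed
      have "(F has_real_derivative 4 * (- ((1 - t) ^ (k + 1)) - - ((1 - t) ^ k))) (at t)"
        unfolding F_def[abs_def] using *[of k] *[of "Suc k"]
        by (intro DERIV_cmult DERIV_diff) simp_all
      moreover have "4 * (- ((1 - t) ^ (k + 1)) - - ((1 - t) ^ k)) = 4 * (t * (1 - t) ^ k)"
        by (simp add: algebra_simps)
      ultimately show "(F has_real_derivative 4 * (t * (1 - t) ^ k)) (at t)"
        by (simp only:)
    qed auto
    moreover have "F 1 - F 0 = 4 / (real (k + 1) * real (k + 2))"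
      by (simp add: F_def field_simps)
    ultimately show ?thesis by simp
  qed
  finally show ?thesis .
qed

text \<open>
  After expanding the square, the off-diagonal terms vanish by independence and centering.
\<close>

lemma (in prob_space) second_moment_indep_combination:
  fixes e :: "'i \<Rightarrow> 'a \<Rightarrow> real"
  assumes "finite I" and ind: "indep_vars (\<lambda>_. borel) e I"
    and sq: "\<And>i. i \<in> I \<Longrightarrow> integrable M (\<lambda>\<omega>. (e i \<omega>)\<^sup>2)"
    and mean: "\<And>i. i \<in> I \<Longrightarrow> expectation (e i) = 0"
    and var: "\<And>i. i \<in> I \<Longrightarrow> expectation (\<lambda>\<omega>. (e i \<omega>)\<^sup>2) = v"
  shows "(\<integral>\<^sup>+\<omega>. ennreal ((\<Sum>i\<in>I. w i * e i \<omega>)\<^sup>2) \<partial>M) = ennreal (v * (\<Sum>i\<in>I. (w i)\<^sup>2))"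
proof -
  have meas[measurable]: "e i \<in> borel_measurable M" if "i \<in> I" for i
    using ind that by (auto simp: indep_vars_def)
  have int: "integrable M (e i)" if "i \<in> I" for i
    using square_integrable_imp_integrable[OF meas[OF that] sq[OF that]] .
  have cross: "has_bochner_integral M (\<lambda>\<omega>. e i \<omega> * e j \<omega>) (if i = j then v else 0)"
    if "i \<in> I" "j \<in> I" for i j
  proof (cases "i = j")
    case True
    then show ?thesis
      using sq[OF that(1)] var[OF that(1)] by (simp add: has_bochner_integral_iff power2_eq_square)
  next
    case False
    then have "indep_var borel ((\<lambda>f. f i) \<circ> (\<lambda>\<omega>. restrict (\<lambda>l. e l \<omega>) {i}))
      borel ((\<lambda>f. f j) \<circ> (\<lambda>\<omega>. restrict (\<lambda>l. e l \<omega>) {j}))"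
      using that by (intro indep_var_compose[OF indep_var_restrict[OF ind]]) auto
    then have "indep_var borel (e i) borel (e j)" by (simp add: comp_def)
    then show ?thesis
      using int that mean False indep_var_integrable[of "e i" "e j"] indep_var_lebesgue_integral[of "e i" "e j"]
      by (simp add: has_bochner_integral_iff)
  qed
  have "has_bochner_integral M (\<lambda>\<omega>. \<Sum>i\<in>I. \<Sum>j\<in>I. (w i * w j) * (e i \<omega> * e j \<omega>))
      (\<Sum>i\<in>I. \<Sum>j\<in>I. (w i * w j) * (if i = j then v else 0))"
    by (intro has_bochner_integral_sum has_bochner_integral_mult_right cross)
  moreover have "(\<Sum>i\<in>I. w i * e i \<omega>)\<^sup>2 = (\<Sum>i\<in>I. \<Sum>j\<in>I. (w i * w j) * (e i \<omega> * e j \<omega>))" for \<omega>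
    by (simp add: power2_eq_square sum_product mult_ac)
  moreover have "(\<Sum>i\<in>I. \<Sum>j\<in>I. (w i * w j) * (if i = j then v else 0)) = v * (\<Sum>i\<in>I. (w i)\<^sup>2)"
    using assms(1) by (simp add: if_distrib sum_distrib_left power2_eq_square mult_ac cong: if_cong)
  ultimately have "has_bochner_integral M (\<lambda>\<omega>. (\<Sum>i\<in>I. w i * e i \<omega>)\<^sup>2) (v * (\<Sum>i\<in>I. (w i)\<^sup>2))"
    by simp
  then show ?thesis
    by (simp add: has_bochner_integral_iff nn_integral_eq_integral)
qed

section \<open>Neighbours of the new point\<close>

context purf_model
begin

text \<open>
  All primitive variables as one family, so that independence of any two disjoint groups of them is
  an instance of a single fact.
\<close>

definition primitive :: "source \<Rightarrow> 'a \<Rightarrow> real" where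
  "primitive v = (case v of Design i \<Rightarrow> X i | Noise i \<Rightarrow> \<epsilon> i | New_Point \<Rightarrow> X0 | Cut l i \<Rightarrow> U l i)"

lemma primitive_simps [simp]:
  "primitive (Design i) = X i" "primitive (Noise i) = \<epsilon> i"
  "primitive New_Point = X0" "primitive (Cut l i) = U l i"
  by (simp_all add: primitive_def)

lemma indep_primitive: "indep_vars (\<lambda>_. borel) primitive (sources n q k)"
  using independence by (simp add: primitive_def[abs_def])

lemma indep_primitive_subset:
  "J \<subseteq> sources n q k \<Longrightarrow> indep_vars (\<lambda>_. borel) primitive J"
  using indep_vars_subset[OF indep_primitive] .

lemma borel_measurable_primitive: "v \<in> sources n q k \<Longrightarrow> primitive v \<in> borel_measurable P"
  using indep_primitive by (auto simp: indep_vars_def)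

lemma borel_measurable_X [measurable]: "i \<in> {1..n} \<Longrightarrow> X i \<in> borel_measurable P"
  using borel_measurable_primitive[of "Design i"] by (auto simp: sources_def)

lemma borel_measurable_noise [measurable]: "i \<in> {1..n} \<Longrightarrow> \<epsilon> i \<in> borel_measurable P"
  using borel_measurable_primitive[of "Noise i"] by (auto simp: sources_def)

lemma borel_measurable_X0 [measurable]: "X0 \<in> borel_measurable P"
  using borel_measurable_primitive[of New_Point] by (auto simp: sources_def)

lemma borel_measurable_U [measurable]:
  "l \<in> {1..q} \<Longrightarrow> i \<in> {1..k} \<Longrightarrow> U l i \<in> borel_measurable P"
  using borel_measurable_primitive[of "Cut l i"] by (auto simp: sources_def)

text \<open>
  The sample points which, as far as the cuts of tree \<open>l\<close> can tell, lie in the cell of the new point.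
\<close>

definition neighbours :: "nat \<Rightarrow> 'a \<Rightarrow> nat set" where
  "neighbours l \<omega> = {i \<in> {1..n}.
     cut_count k (\<lambda>j. U l j \<omega>) (X i \<omega>) = cut_count k (\<lambda>j. U l j \<omega>) (X0 \<omega>)}"

lemma finite_neighbours [simp]: "finite (neighbours l \<omega>)"
  by (simp add: neighbours_def)

lemma measurable_in_neighbours [measurable]:
  assumes "l \<in> {1..q}"
  shows "Measurable.pred P (\<lambda>\<omega>. i \<in> neighbours l \<omega>)"
proof (cases "i \<in> {1..n}")
  case True
  have "Measurable.pred P (\<lambda>\<omega>. cut_count k (\<lambda>j. U l j \<omega>) (X i \<omega>) = cut_count k (\<lambda>j. U l j \<omega>) (X0 \<omega>))"
    by (rule pred_equal_cut_count[where u = "\<lambda>\<omega> j. U l j \<omega>",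
          OF borel_measurable_U[OF assms] borel_measurable_X[OF True] borel_measurable_X0])
  moreover have "(\<lambda>\<omega>. i \<in> neighbours l \<omega>)
      = (\<lambda>\<omega>. cut_count k (\<lambda>j. U l j \<omega>) (X i \<omega>) = cut_count k (\<lambda>j. U l j \<omega>) (X0 \<omega>))"
    using True by (simp add: neighbours_def)
  ultimately show ?thesis by (simp only:)
next
  case False
  then have "(\<lambda>\<omega>. i \<in> neighbours l \<omega>) = (\<lambda>\<omega>. False)"
    by (auto simp: neighbours_def)
  then show ?thesis by (simp only: measurable_const space_count_space UNIV_I)
qed

lemma card_neighbours:
  "real (card (neighbours l \<omega>)) = (\<Sum>i = 1..n. of_bool (i \<in> neighbours l \<omega>))"
proof -
  have "neighbours l \<omega> \<subseteq> {1..n}" by (auto simp: neighbours_def)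
  then show ?thesis by (simp add: of_bool_def sum.If_cases Int_absorb1)
qed

lemma borel_measurable_card_neighbours [measurable]:
  assumes [measurable]: "l \<in> {1..q}"
  shows "(\<lambda>\<omega>. real (card (neighbours l \<omega>))) \<in> borel_measurable P"
  unfolding card_neighbours by measurable

text \<open>
  The largest distance from the new point to a neighbour. The maximum runs over a fixed index set,
  which makes it measurable; index 0 is never a neighbour and supplies the value 0 when there is
  none.
\<close>

definition spread :: "nat \<Rightarrow> 'a \<Rightarrow> real" where
  "spread l \<omega> = Max ((\<lambda>i. if i \<in> neighbours l \<omega> then \<bar>X i \<omega> - X0 \<omega>\<bar> else 0) ` {0..n})"

lemma borel_measurable_spread [measurable]:
  assumes [measurable]: "l \<in> {1..q}"
  shows "spread l \<in> borel_measurable P"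
proof -
  have "(\<lambda>\<omega>. if i \<in> neighbours l \<omega> then \<bar>X i \<omega> - X0 \<omega>\<bar> else 0) \<in> borel_measurable P"
    if "i \<in> {0..n}" for i
  proof (cases "i = 0")
    case True
    then show ?thesis by (simp add: neighbours_def)
  next
    case False
    then have [measurable]: "i \<in> {1..n}" using that by auto
    show ?thesis by measurable
  qed
  then show ?thesis
    unfolding spread_def[abs_def] by (intro borel_measurable_Max) auto
qed

lemma distance_le_spread:
  assumes "i \<in> neighbours l \<omega>"
  shows "\<bar>X i \<omega> - X0 \<omega>\<bar> \<le> spread l \<omega>"
  unfolding spread_def using assms by (intro Max_ge image_eqI[of _ _ i]) (auto simp: neighbours_def)

lemma less_spreadD:
  assumes "t < spread l \<omega>" and "0 \<le> t"
  shows "\<exists>i \<in> neighbours l \<omega>. t < \<bar>X i \<omega> - X0 \<omega>\<bar>"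
proof -
  have "0 \<in> {0..n}" by simp
  then have "(\<lambda>i. if i \<in> neighbours l \<omega> then \<bar>X i \<omega> - X0 \<omega>\<bar> else 0) ` {0..n} \<noteq> {}"
    by blast
  then have "spread l \<omega> \<in> (\<lambda>i. if i \<in> neighbours l \<omega> then \<bar>X i \<omega> - X0 \<omega>\<bar> else 0) ` {0..n}"
    unfolding spread_def by (intro Max_in finite_imageI) simp_all
  then show ?thesis using assms by (auto split: if_splits)
qed

lemma spread_range:
  assumes "\<omega> \<in> space P"
  shows "spread l \<omega> \<in> {0..1}"
proof -
  have "0 \<le> spread l \<omega>"
    unfolding spread_def by (intro Max_ge image_eqI[of _ _ 0]) (auto simp: neighbours_def)
  moreover have "\<bar>X i \<omega> - X0 \<omega>\<bar> \<le> 1" if "i \<in> neighbours l \<omega>" for i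
    using X_range[of i \<omega>] X0_range[OF assms] assms that by (auto simp: neighbours_def)
  then have "\<not> 1 < spread l \<omega>"
    using less_spreadD[of 1 l \<omega>] by fastforce
  ultimately show ?thesis by simp
qed

section \<open>Expected size of a cell\<close>

text \<open>
  With the new point frozen, the event says that all \<open>k\<close> cuts of one tree miss a fixed subinterval of
  length \<open>t\<close>. The shifts \<open>\<delta> = 0\<close> and \<open>\<delta> = - t\<close> give the intervals to the right and to the left of the
  new point.
\<close>

lemma emeasure_cuts_miss:
  assumes l: "l \<in> {1..q}" and t: "t \<in> {0..1}"
  shows "emeasure P {\<omega> \<in> space P. 0 \<le> X0 \<omega> + \<delta> \<and> X0 \<omega> + \<delta> + t \<le> 1 \<and>
      (\<forall>i\<in>{1..k}. U l i \<omega> \<notin> {X0 \<omega> + \<delta>..<X0 \<omega> + \<delta> + t})} \<le> ennreal ((1 - t) ^ k)"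
    (is "emeasure P ?E \<le> _")
proof -
  define A where "A = {New_Point}"
  define B where "B = Cut l ` {1..k}"
  define f :: "(source \<Rightarrow> real) \<times> (source \<Rightarrow> real) \<Rightarrow> ennreal" where
    "f = (\<lambda>(a, b). indicator {x. 0 \<le> x + \<delta> \<and> x + \<delta> + t \<le> 1 \<and>
       (\<forall>i\<in>{1..k}. b (Cut l i) \<notin> {x + \<delta>..<x + \<delta> + t})} (a New_Point))"
  have sub: "A \<subseteq> sources n q k" "B \<subseteq> sources n q k" "A \<inter> B = {}"
    using l by (auto simp: A_def B_def sources_def)
  have [measurable]: "(\<lambda>z. fst z New_Point) \<in> borel_measurable (PiM A (\<lambda>_. borel) \<Otimes>\<^sub>M PiM B (\<lambda>_. borel))"
    by (rule measurable_compose[OF measurable_fst measurable_component_singleton]) (simp add: A_def)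
  have [measurable]: "(\<lambda>z. snd z (Cut l i)) \<in> borel_measurable (PiM A (\<lambda>_. borel) \<Otimes>\<^sub>M PiM B (\<lambda>_. borel))"
    if "i \<in> {1..k}" for i
    by (rule measurable_compose[OF measurable_snd measurable_component_singleton]) (use that in \<open>simp add: B_def\<close>)
  have f[measurable]: "f \<in> borel_measurable (PiM A (\<lambda>_. borel) \<Otimes>\<^sub>M PiM B (\<lambda>_. borel))"
    unfolding f_def case_prod_beta indicator_def mem_Collect_eq atLeastLessThan_iff
    by measurable
  have "emeasure P ?E = (\<integral>\<^sup>+\<omega>. f (\<lambda>v\<in>A. primitive v \<omega>, \<lambda>v\<in>B. primitive v \<omega>) \<partial>P)"
  proof -
    have "?E \<in> sets P"
      using l unfolding atLeastLessThan_iff by measurable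
    then have "emeasure P ?E = (\<integral>\<^sup>+\<omega>. indicator ?E \<omega> \<partial>P)"
      by (rule nn_integral_indicator[symmetric])
    also have "\<dots> = (\<integral>\<^sup>+\<omega>. f (\<lambda>v\<in>A. primitive v \<omega>, \<lambda>v\<in>B. primitive v \<omega>) \<partial>P)"
      by (intro nn_integral_cong) (auto simp: f_def A_def B_def indicator_def)
    finally show ?thesis .
  qed
  also have "\<dots> = (\<integral>\<^sup>+\<omega>. (\<integral>\<^sup>+\<omega>'. f (\<lambda>v\<in>A. primitive v \<omega>, \<lambda>v\<in>B. primitive v \<omega>') \<partial>P) \<partial>P)"
    by (rule nn_integral_indep_var[OF indep_var_restrict[OF indep_primitive]]) (use sub in auto)
  also have "\<dots> \<le> (\<integral>\<^sup>+\<omega>. ennreal ((1 - t) ^ k) \<partial>P)"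
  proof (rule nn_integral_mono)
    fix \<omega>
    define x where "x = X0 \<omega> + \<delta>"
    show "(\<integral>\<^sup>+\<omega>'. f (\<lambda>v\<in>A. primitive v \<omega>, \<lambda>v\<in>B. primitive v \<omega>') \<partial>P) \<le> ennreal ((1 - t) ^ k)"
    proof (cases "0 \<le> x \<and> x + t \<le> 1")
      case True
      have "(\<integral>\<^sup>+\<omega>'. f (\<lambda>v\<in>A. primitive v \<omega>, \<lambda>v\<in>B. primitive v \<omega>') \<partial>P)
          = (\<integral>\<^sup>+\<omega>'. indicator {\<omega>' \<in> space P. \<forall>v\<in>B. primitive v \<omega>' \<notin> {x..<x + t}} \<omega>' \<partial>P)"
        using True by (intro nn_integral_cong) (auto simp: f_def A_def B_def x_def indicator_def)
      also have "\<dots> = emeasure P {\<omega>' \<in> space P. \<forall>v\<in>B. primitive v \<omega>' \<notin> {x..<x + t}}"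
      proof (rule nn_integral_indicator)
        show "{\<omega>' \<in> space P. \<forall>v\<in>B. primitive v \<omega>' \<notin> {x..<x + t}} \<in> sets P"
        proof -
          have "{\<omega>' \<in> space P. \<forall>v\<in>B. primitive v \<omega>' \<notin> {x..<x + t}}
              = {\<omega>' \<in> space P. \<forall>i\<in>{1..k}. \<not> (x \<le> U l i \<omega>' \<and> U l i \<omega>' < x + t)}"
            by (simp add: B_def)
          also have "\<dots> \<in> sets P" using l by measurable
          finally show ?thesis .
        qed
      qed
      also have "\<dots> = ennreal ((1 - t) ^ card B)"
        using True t U_law l sub
        by (intro prob_all_miss_interval indep_primitive_subset) (auto simp: B_def)
      also have "card B = k"
        by (simp add: B_def card_image inj_on_def)
      finally show ?thesis by (rule eq_refl)
    next
      case False
      then have "f (\<lambda>v\<in>A. primitive v \<omega>, b) = 0" for b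
        by (auto simp: f_def A_def x_def indicator_def)
      then show ?thesis by simp
    qed
  qed
  also have "\<dots> = ennreal ((1 - t) ^ k)"
    by (simp add: emeasure_space_1)
  finally show ?thesis .
qed

text \<open>
  If some neighbour is farther than \<open>t\<close> from the new point, then no cut separates the two, so all cuts
  miss an interval of length \<open>t\<close> that has the new point as an endpoint and stays inside the unit
  interval.
\<close>

lemma spread_tail:
  assumes l: "l \<in> {1..q}" and t: "t \<in> {0..1}"
  shows "emeasure P {\<omega> \<in> space P. t < spread l \<omega>} \<le> ennreal (2 * (1 - t) ^ k)"
proof -
  define E where "E \<delta> = {\<omega> \<in> space P. 0 \<le> X0 \<omega> + \<delta> \<and> X0 \<omega> + \<delta> + t \<le> 1 \<and>
      (\<forall>i\<in>{1..k}. U l i \<omega> \<notin> {X0 \<omega> + \<delta>..<X0 \<omega> + \<delta> + t})}" for \<delta>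
  have E: "E \<delta> \<in> sets P" for \<delta>
    using l unfolding E_def atLeastLessThan_iff by measurable
  have "{\<omega> \<in> space P. t < spread l \<omega>} \<subseteq> E 0 \<union> E (- t)"
  proof
    fix \<omega> assume "\<omega> \<in> {\<omega> \<in> space P. t < spread l \<omega>}"
    then have \<omega>: "\<omega> \<in> space P" and "t < spread l \<omega>" by auto
    then obtain i where i: "i \<in> neighbours l \<omega>" and far: "t < \<bar>X i \<omega> - X0 \<omega>\<bar>"
      using less_spreadD t by fastforce
    have cc: "cut_count k (\<lambda>j. U l j \<omega>) (X i \<omega>) = cut_count k (\<lambda>j. U l j \<omega>) (X0 \<omega>)"
      and Xi: "X i \<omega> \<in> {0..1}"
      using i X_range \<omega> by (auto simp: neighbours_def)
    show "\<omega> \<in> E 0 \<union> E (- t)"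
    proof (cases "X0 \<omega> \<le> X i \<omega>")
      case True
      then have "U l j \<omega> \<notin> {X0 \<omega>..<X i \<omega>}" if "j \<in> {1..k}" for j
        using equal_cut_count_imp_gap[OF cc[symmetric]] that by auto
      then have "\<omega> \<in> E 0"
        using True far Xi X0_range[OF \<omega>] \<omega> by (fastforce simp: E_def)
      then show ?thesis by simp
    next
      case False
      then have "U l j \<omega> \<notin> {X i \<omega>..<X0 \<omega>}" if "j \<in> {1..k}" for j
        using equal_cut_count_imp_gap[OF cc] that by auto
      then have "\<omega> \<in> E (- t)"
        using False far Xi X0_range[OF \<omega>] \<omega> by (fastforce simp: E_def)
      then show ?thesis by simp
    qed
  qed
  then have "emeasure P {\<omega> \<in> space P. t < spread l \<omega>} \<le> emeasure P (E 0 \<union> E (- t))"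
    using E by (intro emeasure_mono) auto
  also have "\<dots> \<le> emeasure P (E 0) + emeasure P (E (- t))"
    using E by (intro emeasure_subadditive)
  also have "\<dots> \<le> ennreal ((1 - t) ^ k) + ennreal ((1 - t) ^ k)"
    unfolding E_def by (intro add_mono emeasure_cuts_miss l t)
  also have "\<dots> = ennreal (2 * (1 - t) ^ k)"
    using t by (simp add: ennreal_plus[symmetric] del: ennreal_plus)
  finally show ?thesis .
qed

lemma expected_spread_squared:
  assumes "l \<in> {1..q}"
  shows "(\<integral>\<^sup>+\<omega>. ennreal ((spread l \<omega>)\<^sup>2) \<partial>P) \<le> ennreal (4 / (real (k + 1) * real (k + 2)))"
  using assms by (intro second_moment_of_tail spread_range spread_tail) auto

section \<open>Expected number of neighbours and averaged noise\<close>

text \<open>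
  For frozen cuts, the new point and the design points are \<open>n + 1\<close> identically distributed variables,
  classified by at most \<open>k + 1\<close> cells; the class of the new point consists of itself and its
  neighbours.
\<close>

lemma expected_inverse_cell_size:
  assumes l: "l \<in> {1..q}"
  shows "(\<integral>\<^sup>+\<omega>. ennreal (1 / (1 + real (card (neighbours l \<omega>)))) \<partial>P)
    \<le> ennreal (real (k + 1) / real (n + 1))"
proof -
  define A where "A = Cut l ` {1..k}"
  define B where "B = insert New_Point (Design ` {1..n})"
  define c where "c a x = cut_count k (\<lambda>i. a (Cut l i)) x" for a x
  define f :: "(source \<Rightarrow> real) \<times> (source \<Rightarrow> real) \<Rightarrow> ennreal" where
    "f = (\<lambda>(a, b). ennreal (1 / real (card {v \<in> B. c a (b v) = c a (b New_Point)})))"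
  have sub: "A \<subseteq> sources n q k" "B \<subseteq> sources n q k" "A \<inter> B = {}"
    using l by (auto simp: A_def B_def sources_def)
  have B: "finite B" "New_Point \<in> B" "card B = n + 1"
    by (auto simp: B_def card_image inj_on_def card_insert_if)
  have f[measurable]: "f \<in> borel_measurable (PiM A (\<lambda>_. borel) \<Otimes>\<^sub>M PiM B (\<lambda>_. borel))"
  proof -
    have [measurable]: "Measurable.pred (PiM A (\<lambda>_. borel) \<Otimes>\<^sub>M PiM B (\<lambda>_. borel))
        (\<lambda>z. c (fst z) (snd z v) = c (fst z) (snd z New_Point))" if "v \<in> B" for v
      unfolding c_def
    proof (rule pred_equal_cut_count)
      show "(\<lambda>z. snd z v) \<in> borel_measurable (PiM A (\<lambda>_. borel) \<Otimes>\<^sub>M PiM B (\<lambda>_. borel))"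
          "(\<lambda>z. snd z New_Point) \<in> borel_measurable (PiM A (\<lambda>_. borel) \<Otimes>\<^sub>M PiM B (\<lambda>_. borel))"
        using that B(2)
        by (auto intro: measurable_compose[OF measurable_snd measurable_component_singleton])
      show "(\<lambda>z. fst z (Cut l i)) \<in> borel_measurable (PiM A (\<lambda>_. borel) \<Otimes>\<^sub>M PiM B (\<lambda>_. borel))"
        if "i \<in> {1..k}" for i
        by (rule measurable_compose[OF measurable_fst measurable_component_singleton])
          (use that in \<open>simp add: A_def\<close>)
    qed
    have "real (card {v \<in> B. c a (b v) = c a (b New_Point)})
        = (\<Sum>v\<in>B. if c a (b v) = c a (b New_Point) then 1 else 0)" for a b
      using B by (simp add: sum.If_cases Int_def)
    then show ?thesis
      unfolding f_def case_prod_beta using B(2) by simp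
  qed
  have "(\<integral>\<^sup>+\<omega>. ennreal (1 / (1 + real (card (neighbours l \<omega>)))) \<partial>P)
      = (\<integral>\<^sup>+\<omega>. f (\<lambda>v\<in>A. primitive v \<omega>, \<lambda>v\<in>B. primitive v \<omega>) \<partial>P)"
  proof (rule nn_integral_cong)
    fix \<omega>
    let ?a = "\<lambda>v\<in>A. primitive v \<omega>"
    have c: "c ?a x = cut_count k (\<lambda>i. U l i \<omega>) x" for x
      unfolding c_def by (rule cut_count_cong) (auto simp: A_def)
    have "{v \<in> B. c ?a ((\<lambda>v\<in>B. primitive v \<omega>) v) = c ?a ((\<lambda>v\<in>B. primitive v \<omega>) New_Point)}
        = insert New_Point (Design ` neighbours l \<omega>)"
      by (auto simp: c B_def neighbours_def)
    then show "ennreal (1 / (1 + real (card (neighbours l \<omega>)))) = f (?a, \<lambda>v\<in>B. primitive v \<omega>)"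
      by (subst card_insert_disjoint | simp add: f_def card_image inj_on_def image_iff)+
  qed
  also have "\<dots> = (\<integral>\<^sup>+\<omega>. (\<integral>\<^sup>+\<omega>'. f (\<lambda>v\<in>A. primitive v \<omega>, \<lambda>v\<in>B. primitive v \<omega>') \<partial>P) \<partial>P)"
    by (rule nn_integral_indep_var[OF indep_var_restrict[OF indep_primitive]]) (use sub in auto)
  also have "\<dots> \<le> (\<integral>\<^sup>+\<omega>. ennreal (real (k + 1) / real (n + 1)) \<partial>P)"
  proof (rule nn_integral_mono)
    fix \<omega>
    let ?a = "\<lambda>v\<in>A. primitive v \<omega>"
    have g: "c ?a \<in> measurable borel (count_space UNIV)"
      unfolding c_def[abs_def] by (rule measurable_cut_count) auto
    have law: "distr P borel (primitive v) = density lborel (\<lambda>x. ennreal (\<mu> x * indicator {0..1} x))"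
      if "v \<in> B" for v
    proof -
      have "distr P lborel (primitive v) = density lborel (\<lambda>x. ennreal (\<mu> x * indicator {0..1} x))"
        using that X_density X0_density by (auto simp: B_def distributed_def)
      then show ?thesis by (simp cong: distr_cong)
    qed
    have "(\<integral>\<^sup>+\<omega>'. f (?a, \<lambda>v\<in>B. primitive v \<omega>') \<partial>P)
        = (\<integral>\<^sup>+\<omega>'. ennreal (1 / real (card {v \<in> B. c ?a (primitive v \<omega>') = c ?a (primitive New_Point \<omega>')})) \<partial>P)"
      using B(2) by (auto simp: f_def intro!: nn_integral_cong arg_cong[where f = card])
    also have "\<dots> \<le> ennreal (real (k + 1) / real (card B))"
      by (rule expected_inverse_class_size[OF B(1,2) indep_primitive_subset[OF sub(2)] law g])
        (auto simp: c_def cut_count_le)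
    finally show "(\<integral>\<^sup>+\<omega>'. f (?a, \<lambda>v\<in>B. primitive v \<omega>') \<partial>P) \<le> ennreal (real (k + 1) / real (n + 1))"
      using B(3) by simp
  qed
  also have "\<dots> = ennreal (real (k + 1) / real (n + 1))"
    by (simp add: emeasure_space_1)
  finally show ?thesis .
qed

lemma noise_moments:
  assumes "i \<in> {1..n}"
  shows "integrable P (\<lambda>\<omega>. (\<epsilon> i \<omega>)\<^sup>2)" "expectation (\<epsilon> i) = 0"
    "expectation (\<lambda>\<omega>. (\<epsilon> i \<omega>)\<^sup>2) = \<sigma>\<^sup>2"
proof -
  note [measurable] = borel_measurable_noise[OF assms]
  have \<nu>: "\<nu> = distr P borel (\<epsilon> i)" using \<epsilon>_law[OF assms] by simp
  show "integrable P (\<lambda>\<omega>. (\<epsilon> i \<omega>)\<^sup>2)"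
    using \<nu>_square_integrable unfolding \<nu> by (subst (asm) integrable_distr_eq) auto
  show "expectation (\<epsilon> i) = 0"
    using \<nu>_mean unfolding \<nu> by (subst (asm) integral_distr) auto
  show "expectation (\<lambda>\<omega>. (\<epsilon> i \<omega>)\<^sup>2) = \<sigma>\<^sup>2"
    using \<nu>_variance unfolding \<nu>_mean unfolding \<nu> by (subst (asm) integral_distr) auto
qed

text \<open>
  For frozen cuts, design and new point, the average is a combination of the noise variables with
  \<open>N\<close> weights equal to \<open>1 / N\<close>, where \<open>N\<close> is the number of neighbours, and the squares of the weights
  add up to \<open>1 / N\<close>. Both sides are 0 where \<open>N = 0\<close>.
\<close>

lemma expected_noise_average_squared:
  assumes l: "l \<in> {1..q}"
  shows "(\<integral>\<^sup>+\<omega>. ennreal (((\<Sum>i\<in>neighbours l \<omega>. \<epsilon> i \<omega>) / real (card (neighbours l \<omega>)))\<^sup>2) \<partial>P)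
    = (\<integral>\<^sup>+\<omega>. ennreal (\<sigma>\<^sup>2 / real (card (neighbours l \<omega>))) \<partial>P)"
proof -
  define A where "A = Cut l ` {1..k} \<union> insert New_Point (Design ` {1..n})"
  define B where "B = Noise ` {1..n}"
  define c where "c a x = cut_count k (\<lambda>i. a (Cut l i)) x" for a :: "source \<Rightarrow> real" and x
  \<comment> \<open>The weight as a function of the frozen vector alone, independent of the noise vector.\<close>
  define w where "w a i = of_bool (c a (a (Design i)) = c a (a New_Point)) /
      (\<Sum>j = 1..n. of_bool (c a (a (Design j)) = c a (a New_Point)) :: real)" for a i
  have inv_Noise: "inv Noise (Noise i) = i" for i
    by (rule inv_f_f) (simp add: inj_on_def)
  define f :: "(source \<Rightarrow> real) \<times> (source \<Rightarrow> real) \<Rightarrow> ennreal" where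
    "f = (\<lambda>(a, b). ennreal ((\<Sum>v\<in>B. w a (inv Noise v) * b v)\<^sup>2))"
  have sub: "A \<subseteq> sources n q k" "B \<subseteq> sources n q k" "A \<inter> B = {}"
    using l by (auto simp: A_def B_def sources_def)
  have f[measurable]: "f \<in> borel_measurable (PiM A (\<lambda>_. borel) \<Otimes>\<^sub>M PiM B (\<lambda>_. borel))"
  proof -
    have [measurable]: "(\<lambda>z. fst z v) \<in> borel_measurable (PiM A (\<lambda>_. borel) \<Otimes>\<^sub>M PiM B (\<lambda>_. borel))"
      if "v \<in> A" for v
      by (rule measurable_compose[OF measurable_fst measurable_component_singleton[OF that]])
    have [measurable]: "Measurable.pred (PiM A (\<lambda>_. borel) \<Otimes>\<^sub>M PiM B (\<lambda>_. borel))
        (\<lambda>z. c (fst z) (fst z v) = c (fst z) (fst z New_Point))" if "v \<in> A" for v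
      unfolding c_def by (rule pred_equal_cut_count) (use that in \<open>auto simp: A_def\<close>)
    have [measurable]: "(\<lambda>z. snd z v) \<in> borel_measurable (PiM A (\<lambda>_. borel) \<Otimes>\<^sub>M PiM B (\<lambda>_. borel))"
      if "v \<in> B" for v
      by (rule measurable_compose[OF measurable_snd measurable_component_singleton[OF that]])
    have NA[measurable]: "New_Point \<in> A" "i \<in> {1..n} \<Longrightarrow> Design i \<in> A" for i
      by (auto simp: A_def)
    have [measurable]: "(\<lambda>z. w (fst z) (inv Noise v)) \<in> borel_measurable (PiM A (\<lambda>_. borel) \<Otimes>\<^sub>M PiM B (\<lambda>_. borel))"
      if "v \<in> B" for v
    proof -
      have [measurable]: "inv Noise v \<in> {1..n}" using that by (auto simp: B_def inv_Noise)
      show ?thesis unfolding w_def of_bool_def by measurable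
    qed
    show ?thesis
      unfolding f_def case_prod_beta by measurable
  qed
  have w: "w (\<lambda>v\<in>A. primitive v \<omega>) i
      = of_bool (i \<in> neighbours l \<omega>) / real (card (neighbours l \<omega>))" if "i \<in> {1..n}" for i \<omega>
  proof -
    have "c (\<lambda>v\<in>A. primitive v \<omega>) x = cut_count k (\<lambda>i. U l i \<omega>) x" for x
      unfolding c_def by (rule cut_count_cong) (auto simp: A_def)
    then have "(c (\<lambda>v\<in>A. primitive v \<omega>) ((\<lambda>v\<in>A. primitive v \<omega>) (Design i))
          = c (\<lambda>v\<in>A. primitive v \<omega>) ((\<lambda>v\<in>A. primitive v \<omega>) New_Point))
        \<longleftrightarrow> i \<in> neighbours l \<omega>" if "i \<in> {1..n}" for i
      using that by (simp add: neighbours_def A_def)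
    then show ?thesis
      unfolding w_def card_neighbours using that by simp
  qed
  have over_B: "(\<Sum>v\<in>B. h v) = (\<Sum>i = 1..n. h (Noise i))" for h :: "source \<Rightarrow> real"
    unfolding B_def by (subst sum.reindex) (auto simp: inj_on_def)
  have restrict: "(\<Sum>i = 1..n. of_bool (i \<in> neighbours l \<omega>) * h i) = (\<Sum>i\<in>neighbours l \<omega>. h i)"
    for h :: "nat \<Rightarrow> real" and \<omega>
  proof -
    have "neighbours l \<omega> \<subseteq> {1..n}" by (auto simp: neighbours_def)
    then show ?thesis
      by (intro sum.mono_neutral_cong_right) auto
  qed
  have "(\<integral>\<^sup>+\<omega>. ennreal (((\<Sum>i\<in>neighbours l \<omega>. \<epsilon> i \<omega>) / real (card (neighbours l \<omega>)))\<^sup>2) \<partial>P)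
      = (\<integral>\<^sup>+\<omega>. f (\<lambda>v\<in>A. primitive v \<omega>, \<lambda>v\<in>B. primitive v \<omega>) \<partial>P)"
  proof (rule nn_integral_cong)
    fix \<omega>
    have "(\<Sum>v\<in>B. w (\<lambda>v\<in>A. primitive v \<omega>) (inv Noise v) * (\<lambda>v\<in>B. primitive v \<omega>) v)
        = (\<Sum>i = 1..n. of_bool (i \<in> neighbours l \<omega>) * \<epsilon> i \<omega>) / real (card (neighbours l \<omega>))"
      unfolding over_B sum_divide_distrib by (intro sum.cong) (auto simp: w B_def inv_Noise)
    then show "ennreal (((\<Sum>i\<in>neighbours l \<omega>. \<epsilon> i \<omega>) / real (card (neighbours l \<omega>)))\<^sup>2)
        = f (\<lambda>v\<in>A. primitive v \<omega>, \<lambda>v\<in>B. primitive v \<omega>)"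
      unfolding f_def restrict by simp
  qed
  also have "\<dots> = (\<integral>\<^sup>+\<omega>. (\<integral>\<^sup>+\<omega>'. f (\<lambda>v\<in>A. primitive v \<omega>, \<lambda>v\<in>B. primitive v \<omega>') \<partial>P) \<partial>P)"
    by (rule nn_integral_indep_var[OF indep_var_restrict[OF indep_primitive]]) (use sub in auto)
  also have "\<dots> = (\<integral>\<^sup>+\<omega>. ennreal (\<sigma>\<^sup>2 / real (card (neighbours l \<omega>))) \<partial>P)"
  proof (rule nn_integral_cong)
    fix \<omega>
    let ?a = "\<lambda>v\<in>A. primitive v \<omega>"
    have "(\<integral>\<^sup>+\<omega>'. f (?a, \<lambda>v\<in>B. primitive v \<omega>') \<partial>P)
        = (\<integral>\<^sup>+\<omega>'. ennreal ((\<Sum>v\<in>B. w ?a (inv Noise v) * primitive v \<omega>')\<^sup>2) \<partial>P)"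
      by (simp add: f_def)
    also have "\<dots> = ennreal (\<sigma>\<^sup>2 * (\<Sum>v\<in>B. (w ?a (inv Noise v))\<^sup>2))"
      using sub noise_moments
      by (intro second_moment_indep_combination indep_primitive_subset) (auto simp: B_def)
    also have "(\<Sum>v\<in>B. (w ?a (inv Noise v))\<^sup>2) = (\<Sum>i = 1..n. of_bool (i \<in> neighbours l \<omega>) * 1) / (real (card (neighbours l \<omega>)))\<^sup>2"
      unfolding over_B sum_divide_distrib by (intro sum.cong) (auto simp: w power_divide inv_Noise)
    also have "\<dots> = 1 / real (card (neighbours l \<omega>))"
      unfolding restrict by (simp add: power2_eq_square)
    finally show "(\<integral>\<^sup>+\<omega>'. f (?a, \<lambda>v\<in>B. primitive v \<omega>') \<partial>P) = ennreal (\<sigma>\<^sup>2 / real (card (neighbours l \<omega>)))"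
      by (simp only: times_divide_eq_right mult_1_right)
  qed
  finally show ?thesis .
qed

section \<open>Risk of a tree and of the forest\<close>

text \<open>
  The cells are open on the left, so the point 0 belongs to no cell when all cuts are nonnegative. It
  carries no mass, since the design and the new point have a density.
\<close>

lemma AE_positive:
  "AE \<omega> in P. X0 \<omega> \<in> {0<..1} \<and> (\<forall>i\<in>{1..n}. X i \<omega> \<in> {0<..1})"
proof -
  have nonzero: "AE \<omega> in P. Z \<omega> \<noteq> 0" if "distributed P lborel Z f" for Z :: "'a \<Rightarrow> real" and f
  proof (rule AE_distrD[where P = "\<lambda>x. x \<noteq> 0" and M' = lborel])
    show Z: "Z \<in> measurable P lborel" using that by (simp add: distributed_def)
    have [measurable]: "f \<in> borel_measurable lborel" using that by (simp add: distributed_def)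
    have "AE x in density lborel f. x \<noteq> 0"
      using AE_lborel_singleton[of "0::real"] by (subst AE_density) auto
    moreover have "distr P lborel Z = density lborel f"
      using that by (simp add: distributed_def)
    ultimately show "AE x in distr P lborel Z. x \<noteq> 0" by (simp only:)
  qed
  have "AE \<omega> in P. \<forall>i\<in>{1..n}. X i \<omega> \<noteq> 0"
    using nonzero[OF X_density] by (intro AE_finite_allI) auto
  moreover have "AE \<omega> in P. X0 \<omega> \<noteq> 0"
    by (rule nonzero[OF X0_density])
  ultimately show ?thesis
    using AE_space
  proof eventually_elim
    case (elim \<omega>)
    then show ?case
      using X0_range[OF elim(3)] X_range[OF _ elim(3)] by (auto simp: less_le)
  qed
qed

lemma borel_measurable_regression:
  assumes s: "continuous_on {0..1} s" and [measurable]: "Z \<in> borel_measurable P"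
    and range: "\<And>\<omega>. \<omega> \<in> space P \<Longrightarrow> Z \<omega> \<in> {0..1}"
  shows "(\<lambda>\<omega>. s (Z \<omega>)) \<in> borel_measurable P"
proof -
  have [measurable]: "(\<lambda>x. indicator {0..1} x *\<^sub>R s x) \<in> borel_measurable borel"
    using s by (intro borel_measurable_continuous_on_indicator) auto
  have "(\<lambda>\<omega>. indicator {0..1} (Z \<omega>) *\<^sub>R s (Z \<omega>)) \<in> borel_measurable P"
    by measurable
  then show ?thesis
    using range by (subst measurable_cong[where g = "\<lambda>\<omega>. indicator {0..1} (Z \<omega>) *\<^sub>R s (Z \<omega>)"]) auto
qed

definition tree_sq_error :: "nat \<Rightarrow> 'a \<Rightarrow> real" where
  "tree_sq_error l \<omega> =
     (tree_estimator n (\<lambda>i. X i \<omega>) (\<lambda>i. Y i \<omega>) k (\<lambda>i. U l i \<omega>) (X0 \<omega>) - s (X0 \<omega>))\<^sup>2"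

lemma borel_measurable_tree:
  assumes s: "continuous_on {0..1} s" and l: "l \<in> {1..q}"
  shows "(\<lambda>\<omega>. tree_estimator n (\<lambda>i. X i \<omega>) (\<lambda>i. Y i \<omega>) k (\<lambda>i. U l i \<omega>) (X0 \<omega>))
    \<in> borel_measurable P"
proof (rule borel_measurable_tree_estimator)
  show "Y i \<in> borel_measurable P" if i: "i \<in> {1..n}" for i
  proof -
    have "(\<lambda>\<omega>. s (X i \<omega>)) \<in> borel_measurable P"
      using i X_range by (intro borel_measurable_regression[OF s]) auto
    then have "(\<lambda>\<omega>. s (X i \<omega>) + \<epsilon> i \<omega>) \<in> borel_measurable P"
      using borel_measurable_noise[OF i] by (rule borel_measurable_add)
    then show ?thesis
      using Y_eq[OF i] by (simp cong: measurable_cong)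
  qed
qed (use l in auto)

lemma borel_measurable_tree_sq_error:
  assumes s: "continuous_on {0..1} s" and l: "l \<in> {1..q}"
  shows "tree_sq_error l \<in> borel_measurable P"
  unfolding tree_sq_error_def[abs_def]
  by (intro borel_measurable_power borel_measurable_diff borel_measurable_tree
      borel_measurable_regression s l borel_measurable_X0 X0_range)

text \<open>
  The three terms are the bias, controlled by the Lipschitz constant, the noise, and the price of an
  empty cell. The last one replaces the indicator of having no neighbour by \<open>1 / (1 + N)\<close>, with \<open>N\<close>
  the number of neighbours, which is the quantity that exchangeability controls.
\<close>

lemma tree_sq_error_le:
  assumes lip: "C-lipschitz_on {0..1} s" and S: "\<And>x. x \<in> {0..1} \<Longrightarrow> \<bar>s x\<bar> \<le> S"
    and pos: "X0 \<omega> \<in> {0<..1}" "\<And>i. i \<in> {1..n} \<Longrightarrow> X i \<omega> \<in> {0<..1}"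
    and \<omega>: "\<omega> \<in> space P"
  shows "tree_sq_error l \<omega> \<le> 2 * C\<^sup>2 * (spread l \<omega>)\<^sup>2
    + 2 * ((\<Sum>i\<in>neighbours l \<omega>. \<epsilon> i \<omega>) / real (card (neighbours l \<omega>)))\<^sup>2
    + S\<^sup>2 * (1 / (1 + real (card (neighbours l \<omega>))))"
proof -
  have C: "0 \<le> C" using lip by (rule lipschitz_on_nonneg)
  have x0: "X0 \<omega> \<in> {0..1}" using pos by auto
  have "tree_estimator n (\<lambda>i. X i \<omega>) (\<lambda>i. Y i \<omega>) k (\<lambda>i. U l i \<omega>) (X0 \<omega>)
      = (\<Sum>i\<in>neighbours l \<omega>. Y i \<omega>) / real (card (neighbours l \<omega>))"
    unfolding neighbours_def using pos by (rule tree_estimator_eq_cut_count)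
  also have "(\<Sum>i\<in>neighbours l \<omega>. Y i \<omega>) = (\<Sum>i\<in>neighbours l \<omega>. s (X i \<omega>) + \<epsilon> i \<omega>)"
    using Y_eq[OF _ \<omega>] by (intro sum.cong) (auto simp: neighbours_def)
  finally have "tree_sq_error l \<omega>
      = ((\<Sum>i\<in>neighbours l \<omega>. s (X i \<omega>) + \<epsilon> i \<omega>) / real (card (neighbours l \<omega>)) - s (X0 \<omega>))\<^sup>2"
    by (simp add: tree_sq_error_def)
  also have "\<dots> \<le> 2 * (C * spread l \<omega>)\<^sup>2
      + 2 * ((\<Sum>i\<in>neighbours l \<omega>. \<epsilon> i \<omega>) / real (card (neighbours l \<omega>)))\<^sup>2
      + S\<^sup>2 * of_bool (neighbours l \<omega> = {})"
  proof (rule local_mean_sq_error_le)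
    show "\<bar>s (X i \<omega>) - s (X0 \<omega>)\<bar> \<le> C * spread l \<omega>" if i: "i \<in> neighbours l \<omega>" for i
    proof -
      have "X i \<omega> \<in> {0..1}" using i X_range[OF _ \<omega>] by (auto simp: neighbours_def)
      then have "\<bar>s (X i \<omega>) - s (X0 \<omega>)\<bar> \<le> C * \<bar>X i \<omega> - X0 \<omega>\<bar>"
        using lipschitz_onD[OF lip _ x0] by (simp add: dist_real_def)
      also have "\<dots> \<le> C * spread l \<omega>"
        using distance_le_spread[OF i] C by (rule mult_left_mono)
      finally show ?thesis .
    qed
    show "0 \<le> C * spread l \<omega>" using C spread_range[OF \<omega>] by simp
  qed (use S[OF x0] in auto)
  also have "\<dots> \<le> 2 * C\<^sup>2 * (spread l \<omega>)\<^sup>2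
      + 2 * ((\<Sum>i\<in>neighbours l \<omega>. \<epsilon> i \<omega>) / real (card (neighbours l \<omega>)))\<^sup>2
      + S\<^sup>2 * (1 / (1 + real (card (neighbours l \<omega>))))"
    by (cases "neighbours l \<omega> = {}") (auto simp: power_mult_distrib)
  finally show ?thesis .
qed

text \<open>
  The bias contributes the first summand, through the mean square of the spread; the noise and the
  empty cells contribute the second.
\<close>

definition risk_bound :: "real \<Rightarrow> real \<Rightarrow> real" where
  "risk_bound C S = 2 * C\<^sup>2 * (4 / (real (k + 1) * real (k + 2)))
     + (4 * \<sigma>\<^sup>2 + S\<^sup>2) * (real (k + 1) / real (n + 1))"

lemma risk_bound_nonneg: "0 \<le> risk_bound C S"
  by (simp add: risk_bound_def)

lemma tree_risk:
  assumes lip: "C-lipschitz_on {0..1} s" and S: "\<And>x. x \<in> {0..1} \<Longrightarrow> \<bar>s x\<bar> \<le> S"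
    and l: "l \<in> {1..q}"
  shows "(\<integral>\<^sup>+\<omega>. ennreal (tree_sq_error l \<omega>) \<partial>P) \<le> ennreal (risk_bound C S)"
proof -
  define N where "N \<omega> = real (card (neighbours l \<omega>))" for \<omega>
  define V where "V \<omega> = (\<Sum>i\<in>neighbours l \<omega>. \<epsilon> i \<omega>) / N \<omega>" for \<omega>
  define b where "b = 4 / (real (k + 1) * real (k + 2))"
  define c where "c = real (k + 1) / real (n + 1)"
  have bc: "0 \<le> b" "0 \<le> c" by (simp_all add: b_def c_def)
  note [measurable] = l
  have N[measurable]: "N \<in> borel_measurable P"
    unfolding N_def[abs_def] using l by (rule borel_measurable_card_neighbours)
  have sp[measurable]: "spread l \<in> borel_measurable P"
    using l by (rule borel_measurable_spread)
  have V[measurable]: "V \<in> borel_measurable P"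
  proof -
    have "(\<Sum>i\<in>neighbours l \<omega>. \<epsilon> i \<omega>) = (\<Sum>i = 1..n. if i \<in> neighbours l \<omega> then \<epsilon> i \<omega> else 0)" for \<omega>
    proof -
      have "neighbours l \<omega> \<subseteq> {1..n}" by (auto simp: neighbours_def)
      then show ?thesis by (simp add: sum.If_cases Int_absorb1)
    qed
    moreover have "(\<lambda>\<omega>. \<Sum>i = 1..n. if i \<in> neighbours l \<omega> then \<epsilon> i \<omega> else 0) \<in> borel_measurable P"
      using measurable_in_neighbours[OF l] borel_measurable_noise
      by (intro borel_measurable_sum measurable_If) auto
    ultimately show ?thesis
      unfolding V_def[abs_def] using N by (intro borel_measurable_divide) auto
  qed
  have "(\<integral>\<^sup>+\<omega>. ennreal (tree_sq_error l \<omega>) \<partial>P)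
      \<le> (\<integral>\<^sup>+\<omega>. ennreal (2 * C\<^sup>2) * ennreal ((spread l \<omega>)\<^sup>2) + 2 * ennreal ((V \<omega>)\<^sup>2)
          + ennreal (S\<^sup>2) * ennreal (1 / (1 + N \<omega>)) \<partial>P)"
  proof (rule nn_integral_mono_AE)
    show "AE \<omega> in P. ennreal (tree_sq_error l \<omega>)
      \<le> ennreal (2 * C\<^sup>2) * ennreal ((spread l \<omega>)\<^sup>2) + 2 * ennreal ((V \<omega>)\<^sup>2)
          + ennreal (S\<^sup>2) * ennreal (1 / (1 + N \<omega>))"
      using AE_positive AE_space
    proof eventually_elim
      case (elim \<omega>)
      have "ennreal (tree_sq_error l \<omega>) \<le> ennreal (2 * C\<^sup>2 * (spread l \<omega>)\<^sup>2 + 2 * (V \<omega>)\<^sup>2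
          + S\<^sup>2 * (1 / (1 + N \<omega>)))"
        unfolding V_def N_def using elim
        by (intro ennreal_leI tree_sq_error_le[OF lip S]) auto
      also have "\<dots> = ennreal (2 * C\<^sup>2) * ennreal ((spread l \<omega>)\<^sup>2) + 2 * ennreal ((V \<omega>)\<^sup>2)
          + ennreal (S\<^sup>2) * ennreal (1 / (1 + N \<omega>))"
      proof -
        define w where "w = 1 / (1 + N \<omega>)"
        have "0 \<le> w" by (simp add: w_def N_def)
        then show ?thesis unfolding w_def[symmetric] by (simp add: ennreal_mult')
      qed
      finally show ?case .
    qed
  qed
  also have "\<dots> = ennreal (2 * C\<^sup>2) * (\<integral>\<^sup>+\<omega>. ennreal ((spread l \<omega>)\<^sup>2) \<partial>P)
      + 2 * (\<integral>\<^sup>+\<omega>. ennreal ((V \<omega>)\<^sup>2) \<partial>P)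
      + ennreal (S\<^sup>2) * (\<integral>\<^sup>+\<omega>. ennreal (1 / (1 + N \<omega>)) \<partial>P)"
    by (simp add: nn_integral_add nn_integral_cmult)
  also have "\<dots> \<le> ennreal (2 * C\<^sup>2) * ennreal b + ennreal (4 * \<sigma>\<^sup>2) * ennreal c + ennreal (S\<^sup>2) * ennreal c"
  proof (intro add_mono mult_left_mono)
    show "(\<integral>\<^sup>+\<omega>. ennreal ((spread l \<omega>)\<^sup>2) \<partial>P) \<le> ennreal b"
      unfolding b_def using l by (rule expected_spread_squared)
    show inv: "(\<integral>\<^sup>+\<omega>. ennreal (1 / (1 + N \<omega>)) \<partial>P) \<le> ennreal c"
      unfolding c_def N_def using l by (rule expected_inverse_cell_size)
    have "2 * (\<integral>\<^sup>+\<omega>. ennreal ((V \<omega>)\<^sup>2) \<partial>P) = 2 * (\<integral>\<^sup>+\<omega>. ennreal (\<sigma>\<^sup>2 / N \<omega>) \<partial>P)"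
      unfolding V_def N_def using expected_noise_average_squared[OF l] by simp
    also have "\<dots> = (\<integral>\<^sup>+\<omega>. 2 * ennreal (\<sigma>\<^sup>2 / N \<omega>) \<partial>P)"
      by (subst nn_integral_cmult) auto
    also have "\<dots> \<le> (\<integral>\<^sup>+\<omega>. ennreal (4 * \<sigma>\<^sup>2) * ennreal (1 / (1 + N \<omega>)) \<partial>P)"
    proof (rule nn_integral_mono)
      fix \<omega>
      \<comment> \<open>The factor 2 pays for passing from \<open>1 / N\<close> to \<open>1 / (1 + N)\<close>, and is enough as \<open>N\<close> is 0 or at least 1.\<close>
      have "2 * (\<sigma>\<^sup>2 / N \<omega>) \<le> 4 * \<sigma>\<^sup>2 * (1 / (1 + N \<omega>))"
      proof (cases "neighbours l \<omega> = {}")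
        case False
        then have "card (neighbours l \<omega>) \<ge> 1" by (simp add: Suc_leI card_gt_0_iff)
        then have "1 \<le> N \<omega>" by (simp add: N_def)
        then have "1 / N \<omega> \<le> 2 * (1 / (1 + N \<omega>))" by (simp add: field_simps)
        from mult_left_mono[OF this, of "2 * \<sigma>\<^sup>2"] show ?thesis by simp
      qed (simp add: N_def)
      then have "ennreal (2 * (\<sigma>\<^sup>2 / N \<omega>)) \<le> ennreal (4 * \<sigma>\<^sup>2 * (1 / (1 + N \<omega>)))"
        by (rule ennreal_leI)
      moreover have "ennreal (2 * (\<sigma>\<^sup>2 / N \<omega>)) = 2 * ennreal (\<sigma>\<^sup>2 / N \<omega>)"
        by (subst ennreal_mult') auto
      moreover have "ennreal (4 * \<sigma>\<^sup>2 * (1 / (1 + N \<omega>))) = ennreal (4 * \<sigma>\<^sup>2) * ennreal (1 / (1 + N \<omega>))"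
        by (intro ennreal_mult) (auto simp: N_def)
      ultimately show "2 * ennreal (\<sigma>\<^sup>2 / N \<omega>) \<le> ennreal (4 * \<sigma>\<^sup>2) * ennreal (1 / (1 + N \<omega>))"
        by (simp only:)
    qed
    also have "\<dots> = ennreal (4 * \<sigma>\<^sup>2) * (\<integral>\<^sup>+\<omega>. ennreal (1 / (1 + N \<omega>)) \<partial>P)"
      by (subst nn_integral_cmult) auto
    also have "\<dots> \<le> ennreal (4 * \<sigma>\<^sup>2) * ennreal c"
      using inv by (rule mult_left_mono) simp
    finally show "2 * (\<integral>\<^sup>+\<omega>. ennreal ((V \<omega>)\<^sup>2) \<partial>P) \<le> ennreal (4 * \<sigma>\<^sup>2) * ennreal c" .
  qed auto
  also have "\<dots> = ennreal (2 * C\<^sup>2 * b + 4 * \<sigma>\<^sup>2 * c + S\<^sup>2 * c)"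
    using bc by (simp add: ennreal_mult')
  also have "2 * C\<^sup>2 * b + 4 * \<sigma>\<^sup>2 * c + S\<^sup>2 * c = risk_bound C S"
    unfolding risk_bound_def b_def[symmetric] c_def[symmetric] by (simp add: algebra_simps)
  finally show ?thesis .
qed

text \<open>
  Convexity of the square: averaging trees cannot be worse than the average tree.
\<close>

lemma forest_sq_error_le:
  assumes "1 \<le> q"
  shows "forest_sq_error n q k s X Y U X0 \<omega> \<le> (\<Sum>l = 1..q. 1 / real q * tree_sq_error l \<omega>)"
proof -
  define T where "T l = tree_estimator n (\<lambda>i. X i \<omega>) (\<lambda>i. Y i \<omega>) k (\<lambda>i. U l i \<omega>) (X0 \<omega>) - s (X0 \<omega>)" for l
  have q: "0 < real q" using assms by simp
  have "forest_sq_error n q k s X Y U X0 \<omega> = ((\<Sum>l = 1..q. T l) / real q)\<^sup>2"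
    using q by (simp add: forest_sq_error_def forest_estimator_def T_def sum_subtractf field_simps)
  also have "\<dots> \<le> ((\<Sum>l = 1..q. (T l)\<^sup>2) * real q) / (real q)\<^sup>2"
    using sum_squared_le_sum_of_squares[of T "{1..q}"]
    by (auto simp: power_divide intro!: divide_right_mono)
  also have "\<dots> = (\<Sum>l = 1..q. 1 / real q * tree_sq_error l \<omega>)"
    using q by (simp add: tree_sq_error_def T_def power2_eq_square sum_divide_distrib)
  finally show ?thesis .
qed

lemma forest_risk:
  assumes lip: "C-lipschitz_on {0..1} s" and S: "\<And>x. x \<in> {0..1} \<Longrightarrow> \<bar>s x\<bar> \<le> S"
  shows "integrable P (forest_sq_error n q k s X Y U X0)"
    and "1 \<le> q \<Longrightarrow> expectation (forest_sq_error n q k s X Y U X0) \<le> risk_bound C S"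
proof -
  let ?err = "forest_sq_error n q k s X Y U X0"
  have s: "continuous_on {0..1} s" using lip by (rule lipschitz_on_continuous_on)
  have meas: "?err \<in> borel_measurable P"
    unfolding forest_sq_error_def[abs_def] forest_estimator_def
    by (intro borel_measurable_power borel_measurable_diff borel_measurable_times borel_measurable_const
        borel_measurable_sum borel_measurable_tree s borel_measurable_regression borel_measurable_X0 X0_range)
  have nonneg: "0 \<le> ?err \<omega>" for \<omega> by (simp add: forest_sq_error_def)
  have bound: "(\<integral>\<^sup>+\<omega>. ennreal (?err \<omega>) \<partial>P) \<le> ennreal (risk_bound C S)" if q: "1 \<le> q"
  proof -
    have "(\<integral>\<^sup>+\<omega>. ennreal (?err \<omega>) \<partial>P)
        \<le> (\<integral>\<^sup>+\<omega>. (\<Sum>l = 1..q. ennreal (1 / real q) * ennreal (tree_sq_error l \<omega>)) \<partial>P)"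
    proof (rule nn_integral_mono)
      fix \<omega>
      have "ennreal (?err \<omega>) \<le> ennreal (\<Sum>l = 1..q. 1 / real q * tree_sq_error l \<omega>)"
        using q by (intro ennreal_leI forest_sq_error_le)
      also have "\<dots> = (\<Sum>l = 1..q. ennreal (1 / real q * tree_sq_error l \<omega>))"
        by (subst sum_ennreal) (auto simp: tree_sq_error_def)
      also have "\<dots> = (\<Sum>l = 1..q. ennreal (1 / real q) * ennreal (tree_sq_error l \<omega>))"
        by (intro sum.cong refl ennreal_mult) (auto simp: tree_sq_error_def)
      finally show "ennreal (?err \<omega>) \<le> (\<Sum>l = 1..q. ennreal (1 / real q) * ennreal (tree_sq_error l \<omega>))" .
    qed
    also have "\<dots> = (\<Sum>l = 1..q. ennreal (1 / real q) * (\<integral>\<^sup>+\<omega>. ennreal (tree_sq_error l \<omega>) \<partial>P))"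
      using borel_measurable_tree_sq_error[OF s]
      by (subst nn_integral_sum) (auto simp: nn_integral_cmult)
    also have "\<dots> \<le> (\<Sum>l = 1..q. ennreal (1 / real q) * ennreal (risk_bound C S))"
      by (intro sum_mono mult_left_mono tree_risk[OF lip S]) auto
    also have "\<dots> = (\<Sum>l = 1..q. ennreal (1 / real q * risk_bound C S))"
      using risk_bound_nonneg[of C S] by (intro sum.cong refl ennreal_mult[symmetric]) auto
    also have "\<dots> = ennreal (\<Sum>l = 1..q. 1 / real q * risk_bound C S)"
      using risk_bound_nonneg[of C S] by (intro sum_ennreal) simp
    also have "(\<Sum>l = 1..q. 1 / real q * risk_bound C S) = risk_bound C S"
      using q by simp
    finally show ?thesis .
  qed
  show int: "integrable P ?err"
  proof (cases "1 \<le> q")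
    case True
    then show ?thesis
      using bound nonneg meas by (intro integrableI_nonneg) (auto intro: le_less_trans)
  next
    case False
    then have "q = 0" by simp
    then have "?err \<omega> = (s (X0 \<omega>))\<^sup>2" for \<omega>
      by (simp add: forest_sq_error_def forest_estimator_def)
    moreover have "(s (X0 \<omega>))\<^sup>2 \<le> S\<^sup>2" if "\<omega> \<in> space P" for \<omega>
      using S[OF X0_range[OF that]] by (simp add: abs_le_square_iff[symmetric])
    ultimately show ?thesis
      using meas by (intro integrable_const_bound[where B = "S\<^sup>2"]) auto
  qed
  show "expectation ?err \<le> risk_bound C S" if "1 \<le> q"
  proof -
    have "ennreal (expectation ?err) \<le> ennreal (risk_bound C S)"
      using bound[OF that] nn_integral_eq_integral[OF int] nonneg by simp
    then show ?thesis
      by (subst (asm) ennreal_le_iff) (auto simp: risk_bound_def)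
  qed
qed

end

section \<open>Rate of convergence\<close>

text \<open>
  With \<open>m\<close> the cube root of \<open>n\<close>, both \<open>1 / (k + 1)\<^sup>2\<close> and \<open>(k + 1) / n\<close> have the order
  \<open>1 / m\<^sup>2\<close>; this balance is the reason for the choice of \<open>k\<close>. As \<open>1 \<le> m\<close> and \<open>k + 1\<close> is at least 1,
  rounding changes \<open>k + 1\<close> by at most a factor 2 in either direction.
\<close>

lemma risk_bound_rate:
  fixes n k :: nat and A B :: real
  assumes n: "1 \<le> n" and k: "\<bar>real k + 1 - real n powr (1/3)\<bar> < 1" and AB: "0 \<le> A" "0 \<le> B"
  shows "A * (4 / (real (k + 1) * real (k + 2))) + B * (real (k + 1) / real (n + 1))
    \<le> (16 * A + 2 * B) * real n powr (-2/3)"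
proof -
  define m where "m = real n powr (1/3)"
  have m: "1 \<le> m" using n by (simp add: m_def ge_one_powr_ge_zero)
  have m3: "m ^ 3 = real n"
    using n by (simp add: m_def powr_powr powr_realpow[symmetric])
  have rate: "real n powr (-2/3) = 1 / m\<^sup>2"
  proof -
    have "m\<^sup>2 = real n powr (2/3)"
      using n by (simp add: m_def powr_powr powr_realpow[symmetric])
    then show ?thesis by (simp add: powr_minus_divide)
  qed
  have kl: "m / 2 \<le> real (k + 1)" and ku: "real (k + 1) \<le> 2 * m"
    using k m unfolding m_def[symmetric] by auto
  have "(m / 2) * (m / 2) \<le> real (k + 1) * real (k + 2)"
    using kl m by (intro mult_mono) auto
  then have "4 / (real (k + 1) * real (k + 2)) \<le> 4 / ((m / 2) * (m / 2))"
    using m by (intro divide_left_mono) (auto intro!: mult_pos_pos)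
  also have "\<dots> = 16 * (1 / m\<^sup>2)" by (simp add: power2_eq_square)
  finally have 1: "4 / (real (k + 1) * real (k + 2)) \<le> 16 * (1 / m\<^sup>2)" .
  have "real (k + 1) / real (n + 1) \<le> (2 * m) / m ^ 3"
    using ku m n unfolding m3 by (intro frac_le) auto
  also have "\<dots> = 2 * (1 / m\<^sup>2)" using m by (simp add: power2_eq_square power3_eq_cube)
  finally have 2: "real (k + 1) / real (n + 1) \<le> 2 * (1 / m\<^sup>2)" .
  show ?thesis
    using add_mono[OF mult_left_mono[OF 1 AB(1)] mult_left_mono[OF 2 AB(2)]]
    unfolding rate by (simp add: algebra_simps)
qed

theorem corollary2:
  fixes P :: "nat \<Rightarrow> 'a measure"
    and q k :: "nat \<Rightarrow> nat"
    and s \<mu> :: "real \<Rightarrow> real"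
    and \<nu> :: "real measure"
    and \<sigma> M C :: real
    and X Y \<epsilon> :: "nat \<Rightarrow> nat \<Rightarrow> 'a \<Rightarrow> real"
    and X0 :: "nat \<Rightarrow> 'a \<Rightarrow> real"
    and U :: "nat \<Rightarrow> nat \<Rightarrow> nat \<Rightarrow> 'a \<Rightarrow> real"
  assumes model: "\<And>n. n \<ge> 1 \<Longrightarrow>
      purf_model (P n) n (q n) (k n) s \<mu> \<nu> \<sigma> (X n) (Y n) (\<epsilon> n) (X0 n) (U n)"
    and density_bounds: "\<And>x. x \<in> {0..1} \<Longrightarrow> 0 < \<mu> x \<and> \<mu> x \<le> M"
    and lipschitz: "C-lipschitz_on {0..1} s"
    and q_tendsto: "filterlim q at_top sequentially"
    and k_choice: "\<And>n. n \<ge> 1 \<Longrightarrow> \<bar>real (k n) + 1 - real n powr (1/3)\<bar> < 1"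
  shows "\<exists>K>0. \<exists>r :: nat \<Rightarrow> real. r \<in> o(\<lambda>n. real n powr (-2/3)) \<and>
      (\<forall>n\<ge>1. integrable (P n) (forest_sq_error n (q n) (k n) s (X n) (Y n) (U n) (X0 n)) \<and>
        prob_space.expectation (P n) (forest_sq_error n (q n) (k n) s (X n) (Y n) (U n) (X0 n))
          \<le> K * real n powr (-2/3) + r n)"
proof -
  define S where "S = \<bar>s 0\<bar> + C"
  define err where "err n = forest_sq_error n (q n) (k n) s (X n) (Y n) (U n) (X0 n)" for n
  define K where "K = 16 * (2 * C\<^sup>2) + 2 * (4 * \<sigma>\<^sup>2 + S\<^sup>2) + 1"
  \<comment> \<open>Only the finitely many sample sizes with an empty forest need a remainder.\<close>
  define r where "r n = (if q n = 0 then prob_space.expectation (P n) (err n) else 0)" for n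
  have S: "\<bar>s x\<bar> \<le> S" if "x \<in> {0..1}" for x
  proof -
    have "\<bar>s x - s 0\<bar> \<le> C * \<bar>x - 0\<bar>"
      using lipschitz_onD[OF lipschitz that, of 0] by (simp add: dist_real_def)
    also have "\<dots> \<le> C * 1"
      using that lipschitz_on_nonneg[OF lipschitz] by (intro mult_left_mono) auto
    finally show ?thesis by (simp add: S_def)
  qed
  have "K > 0" by (simp add: K_def add_nonneg_pos)
  moreover have "r \<in> o(\<lambda>n. real n powr (-2/3))"
  proof -
    have "eventually (\<lambda>n. 1 \<le> q n) sequentially"
      using q_tendsto by (simp add: filterlim_at_top)
    then have "eventually (\<lambda>n. r n = 0) sequentially"
      by eventually_elim (simp add: r_def)
    then show ?thesis
      by (subst landau_o.small.in_cong[where g = "\<lambda>_. 0"]) auto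
  qed
  moreover have "integrable (P n) (err n) \<and>
      prob_space.expectation (P n) (err n) \<le> K * real n powr (-2/3) + r n" if n: "1 \<le> n" for n
  proof -
    interpret purf_model "P n" n "q n" "k n" s \<mu> \<nu> \<sigma> "X n" "Y n" "\<epsilon> n" "X0 n" "U n"
      using model[OF n] .
    have "expectation (err n) \<le> K * real n powr (-2/3) + r n"
    proof (cases "q n = 0")
      case True
      then show ?thesis using \<open>K > 0\<close> by (simp add: r_def)
    next
      case False
      then have "expectation (err n) \<le> risk_bound C S"
        unfolding err_def using forest_risk(2)[OF lipschitz S] by simp
      also have "\<dots> \<le> (16 * (2 * C\<^sup>2) + 2 * (4 * \<sigma>\<^sup>2 + S\<^sup>2)) * real n powr (-2/3)"
        unfolding risk_bound_def using n k_choice[OF n] by (intro risk_bound_rate) auto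
      also have "\<dots> \<le> K * real n powr (-2/3)"
        unfolding K_def by (intro mult_right_mono) auto
      finally show ?thesis using False by (simp add: r_def)
    qed
    then show ?thesis
      unfolding err_def using forest_risk(1)[OF lipschitz S] by simp
  qed
  ultimately show ?thesis
    unfolding err_def by blast
qed

end
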